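(* Let $\alpha\ge1$ and let $m_0\in W^{1,\infty}(0,\infty)$ be nonnegative, non-decreasing, with $m_0(0)=0$. For $h>0$ let $h_\rho=h$ and $h_t=\dfrac{h}{2\alpha\|(m_0)_\rho\|_\infty^{\alpha-1}\|m_0\|_\infty}$, let $M_j^n$ be given by scheme (M), and let $m^h$ be the continuous piecewise-linear interpolant of the values $M_j^n$ at the nodes $(t_n,\rho_j)=(nh_t,jh_\rho)$ on the triangulation of each cell $[t_n,t_{n+1}]\times[\rho_j,\rho_{j+1}]$ into two triangles along a diagonal. Then the family $\{m^h\}$ is uniformly Lipschitz continuous, and for every $T,P>0$, $m^h\to m$ uniformly on $[0,T]\times[0,P]$ as $h\to0$, where $m$ is the viscosity solution of the mass problem with datum $m_0$. Moreover $\|m(t,\cdot)\|_\infty=\lim_{\rho\to\infty}m(t,\rho)=\|m_0\|_\infty$ and $\|m_\rho(t,\cdot)\|_\infty\le\|(m_0)_\rho\|_\infty$ for all $t\ge0$.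
   Context: Scheme (M): with $H(s)=\big(\min\{s_+,\|(m_0)_\rho\|_\infty\}\big)^\alpha$, $M_j^0=m_0(\rho_j)$ ($j\ge0$), $M_0^n=0$ ($n>0$), $M_j^{n+1}=M_j^n\big/\big(1+h_tH\big(\frac{M_j^n-M_{j-1}^n}{h_\rho}\big)\big)$ for $j\ge1$, $n\ge0$. The mass problem is $m_t+(m_\rho)_+^\alpha m=0$ ($t,\rho>0$), $m(t,0)=0$, $m(0,\cdot)=m_0$; with Fréchet super/subdifferentials $D^\pm$, a continuous $m$ is a viscosity subsolution if $p_1+(p_2)_+^\alpha m\le0$ for all $(p_1,p_2)\in D^+m(t,\rho)$, $m(0,\cdot)\le m_0$, $m(t,0)\le0$; a supersolution with reversed inequalities and $D^-$; a viscosity solution if both (it is unique among bounded uniformly continuous functions). *)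

theory Defs
  imports "HOL-Analysis.Analysis"
begin

definition supnorm :: "(real \<Rightarrow> real) \<Rightarrow> real" where
  "supnorm f = (SUP \<rho>\<in>{0..}. \<bar>f \<rho>\<bar>)"

text \<open>Norm of the derivative in L-infinity of a W^{1,inf} function on (0,inf),
  i.e. its best Lipschitz constant on [0,inf).\<close>
definition lipconst :: "(real \<Rightarrow> real) \<Rightarrow> real" where
  "lipconst f = Inf {L. L-lipschitz_on {0..} f}"

definition Hfun :: "real \<Rightarrow> real \<Rightarrow> real \<Rightarrow> real" where
  "Hfun L \<alpha> s = (min (max s 0) L) powr \<alpha>"

primrec schemeM :: "(real \<Rightarrow> real) \<Rightarrow> real \<Rightarrow> real \<Rightarrow> real \<Rightarrow> nat \<Rightarrow> nat \<Rightarrow> real" where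
  "schemeM m0 \<alpha> ht hr 0 j = m0 (real j * hr)"
| "schemeM m0 \<alpha> ht hr (Suc n) j =
     (if j = 0 then 0
      else schemeM m0 \<alpha> ht hr n j /
           (1 + ht * Hfun (lipconst m0) \<alpha>
                   ((schemeM m0 \<alpha> ht hr n j - schemeM m0 \<alpha> ht hr n (j - 1)) / hr)))"

definition htime :: "(real \<Rightarrow> real) \<Rightarrow> real \<Rightarrow> real \<Rightarrow> real" where
  "htime m0 \<alpha> h = h / (2 * \<alpha> * lipconst m0 powr (\<alpha> - 1) * supnorm m0)"

text \<open>Continuous piecewise-linear interpolant of nodal values V n j at (n*ht, j*hr),
  each cell split into two triangles along a diagonal; d = True: the diagonal
  through (t_n,rho_j),(t_{n+1},rho_{j+1}); d = False: the other diagonal.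
  Meant for t, rho >= 0.\<close>
definition interp :: "bool \<Rightarrow> real \<Rightarrow> real \<Rightarrow> (nat \<Rightarrow> nat \<Rightarrow> real) \<Rightarrow> real \<Rightarrow> real \<Rightarrow> real" where
  "interp d ht hr V t \<rho> =
    (let n = nat \<lfloor>t / ht\<rfloor>; j = nat \<lfloor>\<rho> / hr\<rfloor>;
         a = t / ht - real n; b = \<rho> / hr - real j;
         V00 = V n j; V10 = V (Suc n) j; V01 = V n (Suc j); V11 = V (Suc n) (Suc j)
     in if d then
          (if b \<le> a then V00 + a * (V10 - V00) + b * (V11 - V10)
           else V00 + b * (V01 - V00) + a * (V11 - V01))
        else
          (if a + b \<le> 1 then V00 + a * (V10 - V00) + b * (V01 - V00)
           else V11 + (1 - a) * (V01 - V11) + (1 - b) * (V10 - V11)))"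

definition mh :: "(real \<Rightarrow> real) \<Rightarrow> real \<Rightarrow> bool \<Rightarrow> real \<Rightarrow> real \<Rightarrow> real \<Rightarrow> real" where
  "mh m0 \<alpha> d h t \<rho> = interp d (htime m0 \<alpha> h) h (schemeM m0 \<alpha> (htime m0 \<alpha> h) h) t \<rho>"

definition superdiff :: "(real \<Rightarrow> real \<Rightarrow> real) \<Rightarrow> real \<Rightarrow> real \<Rightarrow> (real \<times> real) set" where
  "superdiff u t \<rho> = {(p1, p2). \<forall>\<epsilon>>0. \<exists>\<delta>>0. \<forall>s \<sigma>.
      dist (s, \<sigma>) (t, \<rho>) < \<delta> \<longrightarrow>
      u s \<sigma> - u t \<rho> - (p1 * (s - t) + p2 * (\<sigma> - \<rho>)) \<le> \<epsilon> * dist (s, \<sigma>) (t, \<rho>)}"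

definition subdiff :: "(real \<Rightarrow> real \<Rightarrow> real) \<Rightarrow> real \<Rightarrow> real \<Rightarrow> (real \<times> real) set" where
  "subdiff u t \<rho> = {(p1, p2). \<forall>\<epsilon>>0. \<exists>\<delta>>0. \<forall>s \<sigma>.
      dist (s, \<sigma>) (t, \<rho>) < \<delta> \<longrightarrow>
      u s \<sigma> - u t \<rho> - (p1 * (s - t) + p2 * (\<sigma> - \<rho>)) \<ge> - \<epsilon> * dist (s, \<sigma>) (t, \<rho>)}"

definition visc_sub :: "real \<Rightarrow> (real \<Rightarrow> real) \<Rightarrow> (real \<Rightarrow> real \<Rightarrow> real) \<Rightarrow> bool" where
  "visc_sub \<alpha> m0 u \<longleftrightarrow>
     continuous_on ({0..} \<times> {0..}) (\<lambda>(t, \<rho>). u t \<rho>) \<and>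
     (\<forall>t>0. \<forall>\<rho>>0. \<forall>(p1, p2)\<in>superdiff u t \<rho>. p1 + (max p2 0) powr \<alpha> * u t \<rho> \<le> 0) \<and>
     (\<forall>\<rho>\<ge>0. u 0 \<rho> \<le> m0 \<rho>) \<and> (\<forall>t\<ge>0. u t 0 \<le> 0)"

definition visc_super :: "real \<Rightarrow> (real \<Rightarrow> real) \<Rightarrow> (real \<Rightarrow> real \<Rightarrow> real) \<Rightarrow> bool" where
  "visc_super \<alpha> m0 u \<longleftrightarrow>
     continuous_on ({0..} \<times> {0..}) (\<lambda>(t, \<rho>). u t \<rho>) \<and>
     (\<forall>t>0. \<forall>\<rho>>0. \<forall>(p1, p2)\<in>subdiff u t \<rho>. p1 + (max p2 0) powr \<alpha> * u t \<rho> \<ge> 0) \<and>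
     (\<forall>\<rho>\<ge>0. u 0 \<rho> \<ge> m0 \<rho>) \<and> (\<forall>t\<ge>0. u t 0 \<ge> 0)"

definition visc_sol :: "real \<Rightarrow> (real \<Rightarrow> real) \<Rightarrow> (real \<Rightarrow> real \<Rightarrow> real) \<Rightarrow> bool" where
  "visc_sol \<alpha> m0 u \<longleftrightarrow> visc_sub \<alpha> m0 u \<and> visc_super \<alpha> m0 u"

end

theory Submission
  imports Defs
begin

text \<open>Under the CFL condition one step of the scheme is monotone in the old values, which yields
  discrete bounds \<open>0 \<le> M\<^sub>j\<^sup>n - M\<^sub>j\<^sub>-\<^sub>1\<^sup>n \<le> L h\<close> and a Lipschitz bound in time. Doubling the variables directly on two
  grids of mesh \<open>h\<close> and \<open>k\<close> shows that the interpolants differ by \<open>O(sqrt (h + k))\<close> locally uniformly in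
  time, so they converge without any compactness or comparison argument for the continuous
  equation. The limit is a viscosity solution because a test function touching it can be transferred
  to a node where the monotone scheme is evaluated, and the value at infinity is preserved thanks to
  slowly decaying discrete barriers of small slope.\<close>

text \<open>The term \<open>H p * u\<close> is nondecreasing in \<open>u\<close> because
  \<open>H\<close> is nonnegative. This is the sign that doubling of variables needs: where one grid
  function exceeds the other, the larger factor may replace the smaller one. Truncating slopes at
  \<open>L\<close> makes \<open>H\<close> globally Lipschitz with constant \<open>K\<close>, and all
  values lie in \<open>[0, S]\<close>. One ratio \<open>\<kappa>\<close> of time step to space step
  therefore makes the scheme monotone for every mesh, with a factor 1/2 to spare. The truncation has
  to disappear again in the limit: the limit has slopes at most \<open>L\<close>, so the space
  components of its semidifferentials are bounded by \<open>L\<close>, where \<open>H\<close> is the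
  true power. The square root is a balance. A penalty of width \<open>\<epsilon>\<close> costs order
  \<open>\<epsilon>\<close> through the Lipschitz bounds and order
  \<open>(h + k) / \<epsilon>\<close> per unit of time through consistency, hence
  \<open>\<epsilon> = sqrt (h + k)\<close>. These constants do not depend on the space variable, so
  the estimate is uniform on the whole half-line.\<close>

section \<open>Elementary inequalities and the truncated power\<close>

lemma le_of_le_add_mult:
  fixes x y z :: real
  assumes "\<And>\<beta>. \<beta> > 0 \<Longrightarrow> x \<le> y + \<beta> * z" "z \<ge> 0"
  shows "x \<le> y"
proof (rule field_le_epsilon)
  fix e :: real assume "e > 0"
  have "x \<le> y + e / (z + 1) * z"
    using assms \<open>e > 0\<close> by (intro assms(1) divide_pos_pos) auto
  also have "e / (z + 1) * z \<le> e"
    using assms(2) \<open>e > 0\<close> by (simp add: divide_simps mult_left_mono)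
  finally show "x \<le> y + e" by simp
qed

lemma finite_maximizer:
  fixes f :: "'a \<Rightarrow> real"
  assumes "finite F" "F \<noteq> {}"
  obtains z where "z \<in> F" "\<And>w. w \<in> F \<Longrightarrow> f w \<le> f z"
proof -
  have "Max (f ` F) \<in> f ` F" using assms by (intro Max_in) auto
  then obtain z where "z \<in> F" "Max (f ` F) = f z" by auto
  then show ?thesis using that assms(1) by (metis Max_ge finite_imageI imageI)
qed

text \<open>Completing the square. In \<open>doubling\<close> it lets a constant of order
  \<open>e\<close> pay for a Lipschitz term against a quadratic penalty.\<close>

lemma mult_diff_square_le:
  fixes a z e :: real
  assumes "e > 0"
  shows "a * z - z\<^sup>2 / (2 * e) \<le> a\<^sup>2 * e / 2"
proof -
  have "a\<^sup>2 * e / 2 - (a * z - z\<^sup>2 / (2 * e)) = (a * e - z)\<^sup>2 / (2 * e)"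
    using assms by (simp add: field_simps power2_eq_square)
  also have "\<dots> \<ge> 0" using assms by simp
  finally show ?thesis by simp
qed

lemma powr_diff_le:
  fixes x y b \<alpha> :: real
  assumes "0 \<le> x" "x \<le> y" "y \<le> b" "\<alpha> \<ge> 1"
  shows "y powr \<alpha> - x powr \<alpha> \<le> \<alpha> * b powr (\<alpha> - 1) * (y - x)"
proof (cases "x = y")
  case False
  then have "x < y" using assms by simp
  \<comment> \<open>The mean value theorem asks for differentiability only in the open interval, so
    \<open>x = 0\<close> is covered by continuity.\<close>
  have "\<exists>l z. z > x \<and> z < y \<and> ((\<lambda>u. u powr \<alpha>) has_real_derivative l) (at z) \<and>
      y powr \<alpha> - x powr \<alpha> = (y - x) * l"
  proof (rule MVT[OF \<open>x < y\<close>])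
    show "continuous_on {x..y} (\<lambda>u. u powr \<alpha>)"
      using assms by (intro continuous_on_powr') (auto intro: continuous_intros)
    fix u assume "x < u" "u < y"
    then show "(\<lambda>u. u powr \<alpha>) differentiable (at u)"
      using assms has_real_derivative_powr[of u \<alpha>] real_differentiable_def by auto
  qed
  then obtain l z where z: "z > x" "z < y" "((\<lambda>u. u powr \<alpha>) has_real_derivative l) (at z)"
    "y powr \<alpha> - x powr \<alpha> = (y - x) * l" by blast
  have "l = \<alpha> * z powr (\<alpha> - 1)"
    using z assms by (intro DERIV_unique[OF z(3)] has_real_derivative_powr) auto
  moreover have "z powr (\<alpha> - 1) \<le> b powr (\<alpha> - 1)"
    using z assms by (intro powr_mono2) auto
  ultimately have "l \<le> \<alpha> * b powr (\<alpha> - 1)"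
    using assms by (simp add: mult_left_mono)
  then show ?thesis using z(4) \<open>x < y\<close> by (simp add: mult.commute mult_right_mono)
qed (use assms in simp)

lemma Hfun_nonneg: "0 \<le> Hfun L \<alpha> s"
  by (simp add: Hfun_def)

lemma Hfun_mono: "\<lbrakk>L \<ge> 0; \<alpha> \<ge> 0; s \<le> s'\<rbrakk> \<Longrightarrow> Hfun L \<alpha> s \<le> Hfun L \<alpha> s'"
  unfolding Hfun_def by (intro powr_mono2) auto

lemma Hfun_le: "\<lbrakk>L \<ge> 0; \<alpha> \<ge> 0\<rbrakk> \<Longrightarrow> Hfun L \<alpha> s \<le> L powr \<alpha>"
  unfolding Hfun_def by (intro powr_mono2) auto

text \<open>Clipping to \<open>[0, L]\<close> does not increase distances, and on that interval the
  power has slope at most \<open>\<alpha> * L powr (\<alpha> - 1)\<close>.\<close>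

lemma Hfun_diff_le:
  assumes "L \<ge> 0" "\<alpha> \<ge> 1" "s \<le> s'"
  shows "Hfun L \<alpha> s' - Hfun L \<alpha> s \<le> \<alpha> * L powr (\<alpha> - 1) * (s' - s)"
proof -
  have "Hfun L \<alpha> s' - Hfun L \<alpha> s
      \<le> \<alpha> * L powr (\<alpha> - 1) * (min (max s' 0) L - min (max s 0) L)"
    unfolding Hfun_def using assms by (intro powr_diff_le) auto
  also have "\<dots> \<le> \<alpha> * L powr (\<alpha> - 1) * (s' - s)"
    using assms by (intro mult_left_mono) (auto simp: min_def max_def)
  finally show ?thesis .
qed

subsection \<open>Piecewise-linear interpolation\<close>

text \<open>The interpolant in local coordinates, freed from the floor functions, so that it can
  also be evaluated on the far edges \<open>a = 1\<close> and \<open>b = 1\<close> of a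
  cell.\<close>

definition cell_interp :: "bool \<Rightarrow> (nat \<Rightarrow> nat \<Rightarrow> real) \<Rightarrow> nat \<Rightarrow> nat \<Rightarrow> real \<Rightarrow> real \<Rightarrow> real" where
  "cell_interp d V n j a b =
    (if d then
       (if b \<le> a then V n j + a * (V (Suc n) j - V n j) + b * (V (Suc n) (Suc j) - V (Suc n) j)
        else V n j + b * (V n (Suc j) - V n j) + a * (V (Suc n) (Suc j) - V n (Suc j)))
     else
       (if a + b \<le> 1 then V n j + a * (V (Suc n) j - V n j) + b * (V n (Suc j) - V n j)
        else V (Suc n) (Suc j) + (1 - a) * (V n (Suc j) - V (Suc n) (Suc j))
               + (1 - b) * (V (Suc n) j - V (Suc n) (Suc j))))"

text \<open>Gluing across a shared edge: on either side the formula reduces to linear interpolation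
  of the two edge values.\<close>

lemma cell_interp_Suc_0:
  assumes "0 \<le> b" "b \<le> 1"
  shows "cell_interp d V (Suc n) j 0 b = cell_interp d V n j 1 b"
  using assms by (cases "b = 0"; cases d; simp add: cell_interp_def algebra_simps)

lemma cell_interp_0_Suc:
  assumes "0 \<le> a" "a \<le> 1"
  shows "cell_interp d V n (Suc j) a 0 = cell_interp d V n j a 1"
  using assms by (cases "a = 0"; cases "a = 1"; cases d; simp add: cell_interp_def algebra_simps)

lemma interp_eq_cell:
  assumes "ht > 0" "hr > 0" "0 \<le> a" "a \<le> 1" "0 \<le> b" "b \<le> 1"
  shows "interp d ht hr V ((real n + a) * ht) ((real j + b) * hr) = cell_interp d V n j a b"
proof -
  \<comment> \<open>At \<open>c = 1\<close> the floor has already moved to the next cell with local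
    coordinate 0. \<open>N\<close> and \<open>A\<close> record this jump, which the gluing lemmas
    undo at the end.\<close>
  define N where "N k c = (if c = 1 then Suc k else k)" for k :: nat and c :: real
  define A where "A c = (if c = 1 then 0 else c)" for c :: real
  have fl: "nat \<lfloor>real k + c\<rfloor> = N k c" if "0 \<le> c" "c \<le> 1" for k c
  proof (cases "c = 1")
    case True
    then show ?thesis by (simp add: N_def nat_add_distrib)
  next
    case False
    then have "\<lfloor>real k + c\<rfloor> = int k" using that by (intro floor_unique) auto
    then show ?thesis using False by (simp add: N_def)
  qed
  have A: "real k + c - real (N k c) = A c" for k c by (simp add: A_def N_def)
  have "interp d ht hr V t \<rho> = cell_interp d V (nat \<lfloor>t / ht\<rfloor>) (nat \<lfloor>\<rho> / hr\<rfloor>)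
      (t / ht - real (nat \<lfloor>t / ht\<rfloor>)) (\<rho> / hr - real (nat \<lfloor>\<rho> / hr\<rfloor>))" for t \<rho>
    unfolding interp_def cell_interp_def Let_def ..
  moreover have "(real n + a) * ht / ht = real n + a" "(real j + b) * hr / hr = real j + b"
    using assms(1,2) by auto
  ultimately have "interp d ht hr V ((real n + a) * ht) ((real j + b) * hr)
      = cell_interp d V (N n a) (N j b) (A a) (A b)"
    by (simp only: fl[OF assms(3,4)] fl[OF assms(5,6)] A)
  also have "\<dots> = cell_interp d V n j a b"
    using assms(3-6) by (simp add: N_def A_def cell_interp_Suc_0 cell_interp_0_Suc)
  finally show ?thesis .
qed

text \<open>The reflection exchanging \<open>a\<close> and \<open>b\<close> maps either diagonal to
  itself, so estimates in time carry over to space.\<close>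

lemma cell_interp_transpose:
  "cell_interp d V n j a b = cell_interp d (\<lambda>i k. V k i) j n b a"
proof (cases "a = b")
  case True
  then show ?thesis by (auto simp: cell_interp_def algebra_simps)
next
  case False
  then show ?thesis by (auto simp: cell_interp_def algebra_simps)
qed

text \<open>On each triangle the slope in \<open>a\<close> is one of the edge differences
  \<open>X\<close>, \<open>Y\<close>. Moving from \<open>a\<close> to \<open>a'\<close> crosses the
  diagonal at most once, so the increment is \<open>u * X + v * Y\<close>, where \<open>u\<close>
  and \<open>v\<close> are the lengths spent in the two triangles.\<close>

lemma cell_interp_lipschitz:
  assumes V: "\<And>n j. \<bar>V (Suc n) j - V n j\<bar> \<le> D" and "a \<le> a'"
  shows "\<bar>cell_interp d V n j a' b - cell_interp d V n j a b\<bar> \<le> D * (a' - a)"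
proof -
  define X where "X = V (Suc n) (Suc j) - V n (Suc j)"
  define Y where "Y = V (Suc n) j - V n j"
  have XY: "\<bar>X\<bar> \<le> D" "\<bar>Y\<bar> \<le> D" using V by (auto simp: X_def Y_def)
  obtain u v where uv: "u \<ge> 0" "v \<ge> 0" "u + v = a' - a"
    "cell_interp d V n j a' b - cell_interp d V n j a b = u * X + v * Y"
  proof (cases d)
    case True
    show ?thesis
    proof (cases "a' < b")
      case True
      then show ?thesis using \<open>d\<close> \<open>a \<le> a'\<close>
        by (intro that[of "a' - a" 0]) (auto simp: cell_interp_def X_def Y_def algebra_simps)
    next
      case F: False
      show ?thesis
      proof (cases "a < b")
        case True
        then show ?thesis using \<open>d\<close> F
          by (intro that[of "b - a" "a' - b"]) (auto simp: cell_interp_def X_def Y_def algebra_simps)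
      next
        case False
        then show ?thesis using \<open>d\<close> \<open>a \<le> a'\<close> F
          by (intro that[of 0 "a' - a"]) (auto simp: cell_interp_def X_def Y_def algebra_simps)
      qed
    qed
  next
    case False
    show ?thesis
    proof (cases "a' + b \<le> 1")
      case True
      then show ?thesis using \<open>\<not> d\<close> \<open>a \<le> a'\<close>
        by (intro that[of 0 "a' - a"]) (auto simp: cell_interp_def X_def Y_def algebra_simps)
    next
      case F: False
      show ?thesis
      proof (cases "a + b \<le> 1")
        case True
        then show ?thesis using \<open>\<not> d\<close> F
          by (intro that[of "a' + b - 1" "1 - b - a"])
            (auto simp: cell_interp_def X_def Y_def algebra_simps)
      next
        case False
        then show ?thesis using \<open>\<not> d\<close> \<open>a \<le> a'\<close> F
          by (intro that[of "a' - a" 0]) (auto simp: cell_interp_def X_def Y_def algebra_simps)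
      qed
    qed
  qed
  have "\<bar>u * X + v * Y\<bar> \<le> \<bar>u * X\<bar> + \<bar>v * Y\<bar>" by (rule abs_triangle_ineq)
  also have "\<dots> = u * \<bar>X\<bar> + v * \<bar>Y\<bar>" using uv by (simp add: abs_mult)
  also have "\<dots> \<le> u * D + v * D" using uv XY by (intro add_mono mult_left_mono) auto
  also have "\<dots> = D * (a' - a)" using uv by (simp flip: uv(3) add: algebra_simps)
  finally show ?thesis using uv(4) by simp
qed

lemma lipschitz_on_halfline_of_cells:
  fixes f :: "real \<Rightarrow> real"
  assumes "\<delta> > 0" "\<And>n::nat. C-lipschitz_on {real n * \<delta>..real (Suc n) * \<delta>} f"
  shows "C-lipschitz_on {0..} f"
proof -
  have *: "C-lipschitz_on {0..real n * \<delta>} f" for n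
  proof (induction n)
    case 0
    then show ?case using lipschitz_on_nonneg[OF assms(2)[of 0]] by (simp add: lipschitz_on_def)
  next
    case (Suc n)
    show ?case using lipschitz_on_concat[OF Suc assms(2)[of n] refl] by simp
  qed
  show ?thesis
  proof (rule lipschitz_onI)
    fix x y :: real assume xy: "x \<in> {0..}" "y \<in> {0..}"
    obtain n :: nat where "max x y / \<delta> < n" using reals_Archimedean2 by blast
    then have "max x y < n * \<delta>" using assms(1) by (simp add: field_simps)
    then show "dist (f x) (f y) \<le> C * dist x y"
      using xy by (intro lipschitz_onD[OF *[of n]]) auto
  qed (use lipschitz_on_nonneg[OF *[of 0]] in simp)
qed

lemma grid_decomposition:
  assumes "x \<ge> 0" "\<delta> > (0::real)"
  obtains j :: nat and b where "0 \<le> b" "b \<le> 1" "x = (real j + b) * \<delta>"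
    "real j * \<delta> \<le> x" "x \<le> real j * \<delta> + \<delta>"
proof
  let ?j = "nat \<lfloor>x / \<delta>\<rfloor>" let ?b = "x / \<delta> - real ?j"
  have "real ?j = of_int \<lfloor>x / \<delta>\<rfloor>" using assms by simp
  then show b: "0 \<le> ?b" "?b \<le> 1" by linarith+
  show "x = (real ?j + ?b) * \<delta>" using assms by simp
  show "real ?j * \<delta> \<le> x" using b(1) assms by (simp add: field_simps)
  show "x \<le> real ?j * \<delta> + \<delta>" using b(2) assms by (simp add: field_simps)
qed

lemma interp_transpose:
  assumes "ht > 0" "hr > 0" "t \<ge> 0" "\<rho> \<ge> 0"
  shows "interp d ht hr V t \<rho> = interp d hr ht (\<lambda>i k. V k i) \<rho> t"
proof -
  obtain n a where a: "0 \<le> a" "a \<le> 1" "t = (real n + a) * ht"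
    using grid_decomposition[OF assms(3,1)] by metis
  obtain j b where b: "0 \<le> b" "b \<le> 1" "\<rho> = (real j + b) * hr"
    using grid_decomposition[OF assms(4,2)] by metis
  show ?thesis unfolding a(3) b(3)
    using cell_interp_transpose[of d V n j a b] assms a b by (simp add: interp_eq_cell)
qed

lemma interp_lipschitz_time:
  assumes ht: "ht > 0" and hr: "hr > 0" and "\<rho> \<ge> 0"
    and V: "\<And>n j. \<bar>V (Suc n) j - V n j\<bar> \<le> C * ht"
  shows "C-lipschitz_on {0..} (\<lambda>t. interp d ht hr V t \<rho>)"
proof (rule lipschitz_on_halfline_of_cells[OF ht])
  fix n :: nat
  obtain j b where b: "0 \<le> b" "b \<le> 1" "\<rho> = (real j + b) * hr"
    using grid_decomposition[OF assms(3,2)] by metis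
  have "0 \<le> C * ht" using V[of 0 0] by (smt (verit))
  then have C: "C \<ge> 0" using ht by (simp add: zero_le_mult_iff)
  have ord: "\<bar>interp d ht hr V s \<rho> - interp d ht hr V t \<rho>\<bar> \<le> C * (s - t)"
    if "t \<le> s" "real n * ht \<le> t" "s \<le> real (Suc n) * ht" for s t
  proof -
    define a where "a = t / ht - n"
    define a' where "a' = s / ht - n"
    have a: "0 \<le> a" "a \<le> a'" "a' \<le> 1" "t = (real n + a) * ht" "s = (real n + a') * ht"
      using that ht by (auto simp: a_def a'_def field_simps)
    have "\<bar>interp d ht hr V s \<rho> - interp d ht hr V t \<rho>\<bar>
        = \<bar>cell_interp d V n j a' b - cell_interp d V n j a b\<bar>"
      unfolding a(4,5) b(3) using a b ht hr by (simp add: interp_eq_cell)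
    also have "\<dots> \<le> C * ht * (a' - a)" by (rule cell_interp_lipschitz) (use V a(2) in auto)
    also have "\<dots> = C * (s - t)" unfolding a(4,5) by (simp add: algebra_simps)
    finally show ?thesis .
  qed
  show "C-lipschitz_on {real n * ht..real (Suc n) * ht} (\<lambda>t. interp d ht hr V t \<rho>)"
  proof (rule lipschitz_on_leI[OF _ C])
    fix x y assume "x \<in> {real n * ht..real (Suc n) * ht}" "y \<in> {real n * ht..real (Suc n) * ht}" "x \<le> y"
    then show "dist (interp d ht hr V x \<rho>) (interp d ht hr V y \<rho>) \<le> C * dist x y"
      using ord[of x y] by (simp add: dist_real_def abs_minus_commute)
  qed
qed

lemma interp_lipschitz_space:
  assumes "ht > 0" "hr > 0" "t \<ge> 0"
    and V: "\<And>n j. \<bar>V n (Suc j) - V n j\<bar> \<le> C * hr"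
  shows "C-lipschitz_on {0..} (\<lambda>\<rho>. interp d ht hr V t \<rho>)"
proof -
  have "C-lipschitz_on {0..} (\<lambda>\<rho>. interp d hr ht (\<lambda>i k. V k i) \<rho> t)"
    by (rule interp_lipschitz_time) (use assms in auto)
  then show ?thesis
    unfolding lipschitz_on_def using interp_transpose[OF assms(1-3), of _ d V] by auto
qed

subsection \<open>Properties of the scheme\<close>

text \<open>\<open>nontriv\<close> is what makes \<open>L\<close> and \<open>S\<close>, and with
  them the denominator in \<open>htime\<close>, positive.\<close>

locale mass_datum =
  fixes \<alpha> :: real and m0 :: "real \<Rightarrow> real"
  assumes alpha: "\<alpha> \<ge> 1"
    and bdd: "bounded (m0 ` {0..})"
    and lip: "\<exists>L. L-lipschitz_on {0..} m0"
    and nonneg: "\<forall>\<rho>\<ge>0. m0 \<rho> \<ge> 0"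
    and mono: "mono_on {0..} m0"
    and zero: "m0 0 = 0"
    and nontriv: "\<exists>\<rho>\<ge>0. m0 \<rho> \<noteq> 0"
begin

definition L where "L = lipconst m0"
definition S where "S = supnorm m0"
text \<open>Lipschitz constant of \<open>H\<close>. The ratio \<open>\<kappa>\<close> of time step
  to space step below satisfies \<open>S * (\<kappa> * K) = 1 / 2\<close>.\<close>

definition K where "K = \<alpha> * L powr (\<alpha> - 1)"
definition \<kappa> where "\<kappa> = 1 / (2 * K * S)"
text \<open>The bound on the time derivative read off the equation: values at most \<open>S\<close>,
  times \<open>H\<close> at most \<open>L powr \<alpha>\<close>.\<close>

definition C where "C = S * L powr \<alpha>"
definition H where "H = Hfun L \<alpha>"
text \<open>One step of the scheme, with \<open>a\<close> the old value at the node and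
  \<open>b\<close> the old value at its left neighbour.\<close>

definition G where "G h a b = a / (1 + \<kappa> * h * H ((a - b) / h))"
definition M where "M h = schemeM m0 \<alpha> (htime m0 \<alpha> h) h"

section \<open>Norms of the datum and bounds on the truncated Hamiltonian\<close>

text \<open>The infimum is attained, because every difference quotient of \<open>m0\<close> is a
  lower bound for the set of Lipschitz constants.\<close>

lemma L_lipschitz: "L-lipschitz_on {0..} m0"
proof (rule lipschitz_onI)
  let ?A = "{L. L-lipschitz_on {0..} m0}"
  have ne: "?A \<noteq> {}" using lip by auto
  have bb: "bdd_below ?A" using lipschitz_on_nonneg by (intro bdd_belowI[of _ 0]) auto
  show "0 \<le> L" unfolding L_def lipconst_def
    by (intro cInf_greatest[OF ne]) (auto dest: lipschitz_on_nonneg)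
  fix x y :: real assume xy: "x \<in> {0..}" "y \<in> {0..}"
  show "dist (m0 x) (m0 y) \<le> L * dist x y"
  proof (cases "x = y")
    case False
    have "dist (m0 x) (m0 y) / dist x y \<le> L" unfolding L_def lipconst_def
    proof (rule cInf_greatest[OF ne])
      fix l assume "l \<in> ?A"
      then have "dist (m0 x) (m0 y) \<le> l * dist x y" using xy by (auto dest: lipschitz_onD)
      then show "dist (m0 x) (m0 y) / dist x y \<le> l" using False by (simp add: divide_simps)
    qed
    then show ?thesis using False by (simp add: divide_simps)
  qed simp
qed

lemma m0_nonneg: "x \<ge> 0 \<Longrightarrow> 0 \<le> m0 x"
  using nonneg by auto

lemma m0_mono: "0 \<le> x \<Longrightarrow> x \<le> y \<Longrightarrow> m0 x \<le> m0 y"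
  using mono by (auto simp: mono_on_def)

lemma bdd_above_abs_m0: "bdd_above ((\<lambda>x. \<bar>m0 x\<bar>) ` {0..})"
proof -
  obtain B where "\<And>x. x \<in> m0 ` {0..} \<Longrightarrow> norm x \<le> B" using bdd by (auto simp: bounded_iff)
  then show ?thesis by (intro bdd_aboveI[of _ B]) auto
qed

lemma m0_le_S: "x \<ge> 0 \<Longrightarrow> m0 x \<le> S"
  unfolding S_def supnorm_def
  by (rule order_trans[OF abs_ge_self cSUP_upper[OF _ bdd_above_abs_m0]]) auto

lemma m0_near_S:
  assumes "e > 0"
  obtains R where "R \<ge> 0" "m0 R > S - e" "m0 R \<ge> 0"
proof -
  have "S - e < (SUP x\<in>{0..}. \<bar>m0 x\<bar>)" using assms by (simp add: S_def supnorm_def)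
  then obtain R where "R \<ge> 0" "S - e < \<bar>m0 R\<bar>"
    using less_cSUP_iff[OF _ bdd_above_abs_m0] by auto
  then show ?thesis using that m0_nonneg by (metis abs_of_nonneg)
qed

lemma m0_diff_le: "x \<ge> 0 \<Longrightarrow> y \<ge> 0 \<Longrightarrow> \<bar>m0 x - m0 y\<bar> \<le> L * \<bar>x - y\<bar>"
  using lipschitz_onD[OF L_lipschitz, of x y] by (simp add: dist_real_def)

lemma S_pos: "S > 0"
proof -
  obtain r where "r \<ge> 0" "m0 r \<noteq> 0" using nontriv by blast
  then show ?thesis using m0_nonneg[of r] m0_le_S[of r] by linarith
qed

lemma L_pos: "L > 0"
proof (rule ccontr)
  assume "\<not> L > 0"
  then have "L = 0" using lipschitz_on_nonneg[OF L_lipschitz] by simp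
  then have "m0 r = 0" if "r \<ge> 0" for r using m0_diff_le[of r 0] that zero by simp
  then show False using nontriv by blast
qed

lemma K_pos: "K > 0" unfolding K_def using alpha L_pos by simp
lemma kappa_pos: "\<kappa> > 0" unfolding \<kappa>_def using K_pos S_pos by simp
lemma C_nonneg: "C \<ge> 0" unfolding C_def using S_pos by simp
lemma CFL: "S * (\<kappa> * K) = 1 / 2" unfolding \<kappa>_def using K_pos S_pos by simp

lemma htime_eq: "htime m0 \<alpha> h = \<kappa> * h"
  by (simp add: htime_def \<kappa>_def K_def L_def S_def)

lemma H_nonneg: "0 \<le> H s" unfolding H_def by (rule Hfun_nonneg)
lemma H_mono: "s \<le> s' \<Longrightarrow> H s \<le> H s'" unfolding H_def using L_pos alpha by (intro Hfun_mono) auto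
lemma H_le: "H s \<le> L powr \<alpha>" unfolding H_def using L_pos alpha by (intro Hfun_le) auto
lemma H_diff_le: "s \<le> s' \<Longrightarrow> H s' - H s \<le> K * (s' - s)"
  unfolding H_def K_def using L_pos alpha by (intro Hfun_diff_le) auto
lemma H_diff_le_max: "H s' - H s \<le> K * max 0 (s' - s)"
  using H_diff_le[of s s'] H_mono[of s' s] K_pos by (cases "s \<le> s'") (auto simp: max_def)

lemma denom_pos: "h > 0 \<Longrightarrow> 1 + \<kappa> * h * H s \<ge> 1"
  using kappa_pos H_nonneg by simp

lemma M_0: "M h 0 j = m0 (real j * h)"
  by (simp add: M_def)

lemma M_boundary: "M h n 0 = 0"
  by (cases n) (simp_all add: M_def zero)

lemma M_Suc: "M h (Suc n) (Suc j) = G h (M h n (Suc j)) (M h n j)"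
  by (simp add: M_def G_def H_def L_def htime_eq)

section \<open>Monotonicity of a step and discrete Lipschitz bounds\<close>

text \<open>The form in which the CFL condition is used: the mesh cancels, and a slope increase of
  at most \<open>z / h\<close> costs at most half of the value change \<open>z\<close>. Both
  \<open>G_mono\<close> and the slope bound rest on it.\<close>

lemma CFL_H:
  assumes "h > 0" "0 \<le> a" "a \<le> S" "s' - s \<le> z / h" "z \<ge> 0"
  shows "a * (\<kappa> * h * (H s' - H s)) \<le> z / 2"
proof -
  have "H s' - H s \<le> K * (z / h)"
    using H_diff_le_max[of s' s] K_pos assms
    by (smt (verit) divide_nonneg_pos max_def mult_left_mono)
  then have "a * (\<kappa> * h * (H s' - H s)) \<le> a * (\<kappa> * h * (K * (z / h)))"
    using assms kappa_pos by (intro mult_left_mono) auto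
  also have "\<dots> = a * (\<kappa> * K * z)" using assms by simp
  also have "\<dots> \<le> S * (\<kappa> * K * z)"
    using assms kappa_pos K_pos by (intro mult_right_mono) auto
  also have "\<dots> = z / 2" using CFL by (metis mult.assoc mult.commute mult_1 times_divide_eq_left)
  finally show ?thesis .
qed

text \<open>Raising \<open>b\<close> lowers the slope and hence the denominator; raising
  \<open>a\<close> gains more in the numerator than \<open>CFL_H\<close> lets the denominator cost.
  Only the smaller value is bounded by \<open>S\<close> and only the larger one is nonnegative,
  since the test values inserted in \<open>sub_step\<close> may exceed \<open>S\<close> and those in
  \<open>super_step\<close> may be negative.\<close>

lemma G_mono:
  assumes h: "h > 0" and "a \<le> S" "a \<le> a'" "b \<le> b'" "0 \<le> a'"
  shows "G h a b \<le> G h a' b'"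
proof (cases "a \<ge> 0")
  case False
  then have "G h a b \<le> 0" unfolding G_def using denom_pos[OF h]
    by (smt (verit, best) divide_le_0_iff)
  also have "0 \<le> G h a' b'" unfolding G_def using denom_pos[OF h] assms
    by (smt (verit, best) divide_nonneg_pos)
  finally show ?thesis .
next
  case True
  let ?H = "H ((a - b) / h)" and ?H' = "H ((a' - b') / h)"
  have "(a' - b') / h - (a - b) / h \<le> (a' - a) / h"
    using assms by (simp add: divide_simps)
  then have "a * (\<kappa> * h * (?H' - ?H)) \<le> (a' - a) / 2"
    using assms True by (intro CFL_H) auto
  also have "\<dots> \<le> (a' - a) * (1 + \<kappa> * h * ?H)"
  proof -
    have "(a' - a) * (1 / 2) \<le> (a' - a) * (1 + \<kappa> * h * ?H)"
      using denom_pos[OF h, of "(a - b) / h"] assms by (intro mult_left_mono) auto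
    then show ?thesis by simp
  qed
  finally have "a * (1 + \<kappa> * h * ?H') \<le> a' * (1 + \<kappa> * h * ?H)"
    by (simp add: algebra_simps)
  then show ?thesis
    unfolding G_def using denom_pos[OF h, of "(a - b) / h"] denom_pos[OF h, of "(a' - b') / h"]
    by (simp add: divide_simps)
qed

lemma G_le: "h > 0 \<Longrightarrow> a \<ge> 0 \<Longrightarrow> G h a b \<le> a"
  unfolding G_def using denom_pos[of h "(a - b) / h"]
  by (simp add: pos_divide_le_eq mult_le_cancel_left1 del: le_add_same_cancel1)

lemma G_nonneg: "h > 0 \<Longrightarrow> a \<ge> 0 \<Longrightarrow> 0 \<le> G h a b"
  unfolding G_def using denom_pos[of h "(a - b) / h"] by simp

lemma M_bounds: 
  assumes "h > 0"
  shows "0 \<le> M h n j \<and> M h n j \<le> m0 (real j * h)"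
proof (induction n arbitrary: j)
  case 0
  then show ?case using assms m0_nonneg by (simp add: M_0)
next
  case (Suc n)
  show ?case
  proof (cases j)
    case 0
    then show ?thesis using zero by (simp add: M_boundary)
  next
    case (Suc i)
    then show ?thesis using Suc.IH[of j] assms G_nonneg G_le[of h "M h n j" "M h n i"]
      by (auto simp: M_Suc)
  qed
qed

lemma M_nonneg: "h > 0 \<Longrightarrow> 0 \<le> M h n j"
  and M_le_m0: "h > 0 \<Longrightarrow> M h n j \<le> m0 (real j * h)"
  using M_bounds by auto

lemma M_le_S: "h > 0 \<Longrightarrow> M h n j \<le> S"
  by (rule order_trans[OF M_le_m0 m0_le_S]) auto

text \<open>Clearing the denominator of \<open>G\<close> shows that the decrement is the new value
  times \<open>\<kappa> * h * H\<close>, which is bounded by \<open>S\<close> and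
  \<open>L powr \<alpha>\<close>.\<close>

lemma M_time_step:
  assumes "h > 0"
  shows "M h (Suc n) j \<le> M h n j \<and> M h n j - M h (Suc n) j \<le> C * (\<kappa> * h)"
proof (cases j)
  case 0
  then show ?thesis using C_nonneg kappa_pos assms by (simp add: M_boundary)
next
  case (Suc i)
  let ?a = "M h n j" and ?H = "H ((M h n j - M h n i) / h)"
  have a: "0 \<le> ?a" "?a \<le> S" using assms M_nonneg M_le_S by auto
  have "?a - G h ?a (M h n i) = G h ?a (M h n i) * (\<kappa> * h * ?H)"
    unfolding G_def using denom_pos[OF assms, of "(M h n j - M h n i) / h"]
    by (simp add: field_simps)
  also have "\<dots> \<le> S * (\<kappa> * h * L powr \<alpha>)"
    using G_le[OF assms a(1)] a G_nonneg[OF assms a(1)] assms kappa_pos H_nonneg H_le S_pos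
    by (intro mult_mono) (auto intro: order_trans)
  also have "\<dots> = C * (\<kappa> * h)" by (simp add: C_def)
  finally show ?thesis using Suc G_le[OF assms a(1)] by (simp add: M_Suc)
qed

text \<open>A monotone step preserves the order between the row of values and its shift by one node;
  at the boundary nonnegativity takes over.\<close>

lemma M_mono_space: 
  assumes "h > 0"
  shows "M h n j \<le> M h n (Suc j)"
proof (induction n arbitrary: j)
  case 0
  then show ?case using assms by (auto simp: M_0 intro!: m0_mono mult_right_mono)
next
  case (Suc n)
  show ?case
  proof (cases j)
    case 0
    then show ?thesis using M_nonneg[OF assms] by (simp add: M_boundary)
  next
    case (Suc i)
    show ?thesis unfolding Suc M_Suc
      using Suc.IH assms M_le_S M_nonneg by (intro G_mono) auto
  qed
qed

text \<open>The CFL condition gives the new slope as at most the maximum of the two old ones,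
  so the truncation in the Hamiltonian never becomes active.\<close>
lemma M_space_step:
  assumes "h > 0"
  shows "M h n (Suc j) - M h n j \<le> L * h"
proof (induction n arbitrary: j)
  case 0
  have "m0 (real (Suc j) * h) - m0 (real j * h) \<le> L * \<bar>real (Suc j) * h - real j * h\<bar>"
    using m0_diff_le[of "real (Suc j) * h" "real j * h"] assms by simp
  also have "\<bar>real (Suc j) * h - real j * h\<bar> = h" using assms by (simp add: algebra_simps)
  finally show ?case by (simp add: M_0)
next
  case (Suc n)
  show ?case
  proof (cases j)
    case 0
    have "M h (Suc n) 1 \<le> M h n 1" using M_time_step[OF assms] by simp
    then show ?thesis using Suc.IH[of 0] 0 by (simp add: M_boundary)
  next
    case (Suc i)
    let ?a = "M h n (Suc (Suc i))" and ?b = "M h n (Suc i)" and ?c = "M h n i"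
    let ?p = "(?a - ?b) / h" and ?q = "(?b - ?c) / h"
    let ?P = "1 + \<kappa> * h * H ?p" and ?Q = "1 + \<kappa> * h * H ?q"
    have PQ: "?P \<ge> 1" "?Q \<ge> 1" using denom_pos[OF assms] by auto
    have ab: "?a - ?b \<le> L * h" "?b - ?c \<le> L * h" using Suc.IH by auto
    \<comment> \<open>The excess of the left increment over the right one, so that
      \<open>(?a - ?b) + z\<close> is the larger of the two increments.\<close>
    define z where "z = max 0 ((?b - ?c) - (?a - ?b))"
    have "?b * (\<kappa> * h * (H ?q - H ?p)) \<le> z / 2"
    proof (rule CFL_H)
      have "?q - ?p = ((?b - ?c) - (?a - ?b)) / h" by (simp only: diff_divide_distrib)
      also have "\<dots> \<le> z / h" using assms by (intro divide_right_mono) (auto simp: z_def)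
      finally show "?q - ?p \<le> z / h" .
    qed (use assms M_nonneg M_le_S z_def in auto)
    then have 1: "?b * (?Q - ?P) \<le> z" by (simp add: algebra_simps z_def)
    have "?a * ?Q - ?b * ?P = (?a - ?b) * ?Q + ?b * (?Q - ?P)" by (simp add: algebra_simps)
    also have "\<dots> \<le> (?a - ?b) * ?Q + z * ?Q"
      using 1 PQ(2) mult_left_mono[OF PQ(2), of z] by (simp add: z_def)
    also have "\<dots> = ((?a - ?b) + z) * ?Q" by (simp add: algebra_simps)
    also have "\<dots> \<le> L * h * ?Q" using PQ ab by (intro mult_right_mono) (auto simp: z_def)
    also have "\<dots> \<le> L * h * ?Q * ?P"
      using mult_left_mono[OF PQ(1), of "L * h * ?Q"] PQ L_pos assms by simp
    finally have "?a * ?Q - ?b * ?P \<le> L * h * (?P * ?Q)" by (simp add: mult_ac)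
    moreover have "?a / ?P - ?b / ?Q = (?a * ?Q - ?b * ?P) / (?P * ?Q)"
      using PQ by (simp add: field_simps)
    ultimately have "?a / ?P - ?b / ?Q \<le> L * h"
      using PQ by (simp add: divide_le_eq)
    then show ?thesis using Suc by (simp add: M_Suc G_def)
  qed
qed

lemma M_le_linear: "h > 0 \<Longrightarrow> M h n j \<le> L * (real j * h)"
  using M_le_m0[of h n j] m0_diff_le[of "real j * h" 0] zero by simp

lemma M_ge_initial: "h > 0 \<Longrightarrow> m0 (real j * h) - C * (\<kappa> * h * real n) \<le> M h n j"
proof (induction n)
  case 0
  then show ?case by (simp add: M_0)
next
  case (Suc n)
  then show ?case using M_time_step[of h n j] by (simp add: algebra_simps)
qed

section \<open>Discrete viscosity inequalities and comparison of two grids\<close>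

text \<open>The old values lie below an affine function that agrees with \<open>M\<close> at the new
  node and has time slope \<open>- a\<close> and space slope \<open>q\<close>. Monotonicity allows
  inserting that function, on which the step is explicit. The conclusion is the subsolution
  inequality for these slopes.\<close>

lemma sub_step:
  assumes h: "h > 0" and A: "M h n (Suc j) \<le> M h (Suc n) (Suc j) + a * (\<kappa> * h)"
    and B: "M h n j \<le> M h (Suc n) (Suc j) + a * (\<kappa> * h) - h * q"
  shows "M h (Suc n) (Suc j) * H q \<le> a"
proof -
  let ?u = "M h (Suc n) (Suc j)" and ?A = "M h (Suc n) (Suc j) + a * (\<kappa> * h)"
  have "?u \<le> G h ?A (?A - h * q)"
    unfolding M_Suc[of h n j] using A B M_nonneg[OF h] M_le_S[OF h] h
    by (intro G_mono) (auto simp: M_Suc[symmetric] intro: order_trans)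
  also have "\<dots> = ?A / (1 + \<kappa> * h * H q)" using h by (simp add: G_def)
  finally have "?u * (1 + \<kappa> * h * H q) \<le> ?A"
    using denom_pos[OF h, of q] by (simp add: pos_le_divide_eq)
  then have "(?u * H q) * (\<kappa> * h) \<le> a * (\<kappa> * h)" by (simp add: algebra_simps)
  then show ?thesis using kappa_pos h by simp
qed

text \<open>The counterpart with an affine function touching from below; here \<open>?A\<close> may
  be negative.\<close>

lemma super_step:
  assumes h: "h > 0" and A: "M h n (Suc j) \<ge> M h (Suc n) (Suc j) + a * (\<kappa> * h)"
    and B: "M h n j \<ge> M h (Suc n) (Suc j) + a * (\<kappa> * h) - h * q"
  shows "M h (Suc n) (Suc j) * H q \<ge> a"
proof -
  let ?u = "M h (Suc n) (Suc j)" and ?A = "M h (Suc n) (Suc j) + a * (\<kappa> * h)"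
  have "?A \<le> S" using A M_le_S[OF h] order_trans by blast
  then have "G h ?A (?A - h * q) \<le> ?u"
    unfolding M_Suc[of h n j] using A B M_nonneg[OF h] M_le_S[OF h] h
    by (intro G_mono) (auto simp: M_Suc[symmetric])
  moreover have "G h ?A (?A - h * q) = ?A / (1 + \<kappa> * h * H q)" using h by (simp add: G_def)
  ultimately have "?u * (1 + \<kappa> * h * H q) \<ge> ?A"
    using denom_pos[OF h, of q] by (simp add: pos_divide_le_eq)
  then have "(?u * H q) * (\<kappa> * h) \<ge> a * (\<kappa> * h)" by (simp add: algebra_simps)
  then show ?thesis using kappa_pos h by simp
qed

text \<open>At a maximum point the two discrete slopes of the penalty differ by \<open>(h + k) / (2 \<epsilon>)\<close>, and \<open>\<gamma>\<close> is
  chosen to dominate the resulting consistency error. The term in \<open>\<beta>\<close> only provides a maximum on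
  the unbounded grid: it moves both slopes in the favourable direction.\<close>
lemma doubling:
  assumes h: "h > 0" and k: "k > 0" and e: "\<epsilon> > 0"
    and g: "\<gamma> = (\<kappa> + S * K) * (h + k) / (2 * \<epsilon>)"
  shows "M h n i - M k m j \<le> (L\<^sup>2 + C\<^sup>2) * \<epsilon> / 2
     + ((real i * h - real j * k)\<^sup>2 + (real n * (\<kappa> * h) - real m * (\<kappa> * k))\<^sup>2) / (2 * \<epsilon>)
     + \<gamma> * (real n * (\<kappa> * h) + real m * (\<kappa> * k))"
proof (rule le_of_le_add_mult[where z = "real i * h + real j * k"])
  show "0 \<le> real i * h + real j * k" using h k by simp
  fix \<beta> :: real assume beta: "\<beta> > 0"
  have kh: "\<kappa> * h > 0" "\<kappa> * k > 0" using kappa_pos h k by auto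
  have gpos: "\<gamma> > 0" unfolding g using kappa_pos S_pos K_pos h k e
    by (intro divide_pos_pos mult_pos_pos add_pos_pos) auto
  define \<psi> where "\<psi> t x s y = ((x - y)\<^sup>2 + (t - s)\<^sup>2) / (2 * \<epsilon>) + \<gamma> * (t + s) + \<beta> * (x + y)"
    for t x s y :: real
  define \<Phi> where "\<Phi> z = (case z of (n, i, m, j) \<Rightarrow> M h n i - M k m j
      - \<psi> (real n * (\<kappa> * h)) (real i * h) (real m * (\<kappa> * k)) (real j * k))" for z
  define B where "B = (L\<^sup>2 + C\<^sup>2) * \<epsilon> / 2"
  have B: "B \<ge> 0" using e by (simp add: B_def)
  have "\<Phi> (n, i, m, j) \<le> B"
  proof (rule ccontr)
    assume neg: "\<not> \<Phi> (n, i, m, j) \<le> B"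
    \<comment> \<open>The terms in \<open>\<gamma>\<close> and \<open>\<beta>\<close> grow along the
      grids while the values stay in \<open>[0, S]\<close>, so this superlevel set is finite.
      Outside it \<open>\<Phi>\<close> is at most \<open>B\<close>, so a maximum over
      \<open>F\<close> is global.\<close>
    define F where "F = {z. \<Phi> z > B}"
    have "finite F"
    proof -
      obtain N :: nat where N: "S / (\<gamma> * (\<kappa> * h)) \<le> N" "S / (\<gamma> * (\<kappa> * k)) \<le> N"
        "S / (\<beta> * h) \<le> N" "S / (\<beta> * k) \<le> N"
        using real_nat_ceiling_ge[of "Max {S / (\<gamma> * (\<kappa> * h)), S / (\<gamma> * (\<kappa> * k)), S / (\<beta> * h), S / (\<beta> * k)}"]
        by auto
      have "z \<in> {..N} \<times> {..N} \<times> {..N} \<times> {..N}" if "z \<in> F" for z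
      proof -
        obtain n i m j where z: "z = (n, i, m, j)" by (metis prod.exhaust)
        let ?q = "((real i * h - real j * k)\<^sup>2 + (real n * (\<kappa> * h) - real m * (\<kappa> * k))\<^sup>2) / (2 * \<epsilon>)"
        have "?q \<ge> 0" using e by simp
        moreover have "M h n i - M k m j \<le> S" using M_le_S[OF h, of n i] M_nonneg[OF k, of m j] by simp
        moreover have "\<Phi> z > 0" using that B by (simp add: F_def)
        ultimately have le: "\<gamma> * (real n * (\<kappa> * h)) + \<gamma> * (real m * (\<kappa> * k))
            + \<beta> * (real i * h) + \<beta> * (real j * k) \<le> S"
          by (simp add: z \<Phi>_def \<psi>_def distrib_left)
        have nn: "0 \<le> \<gamma> * (real n * (\<kappa> * h))" "0 \<le> \<gamma> * (real m * (\<kappa> * k))"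
          "0 \<le> \<beta> * (real i * h)" "0 \<le> \<beta> * (real j * k)"
          using gpos beta kh h k by auto
        have "real n * (\<gamma> * (\<kappa> * h)) \<le> S" "real m * (\<gamma> * (\<kappa> * k)) \<le> S"
          "real i * (\<beta> * h) \<le> S" "real j * (\<beta> * k) \<le> S"
          using le nn by (simp_all add: mult_ac)
        then have "real n \<le> S / (\<gamma> * (\<kappa> * h))" "real m \<le> S / (\<gamma> * (\<kappa> * k))"
          "real i \<le> S / (\<beta> * h)" "real j \<le> S / (\<beta> * k)"
          using gpos beta kh h k by (simp_all add: pos_le_divide_eq)
        then show ?thesis using N z by (auto intro: order_trans)
      qed
      then show ?thesis by (intro finite_subset[of F "{..N} \<times> {..N} \<times> {..N} \<times> {..N}"]) auto
    qed
    moreover have "(n, i, m, j) \<in> F" using neg by (simp add: F_def)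
    then have "F \<noteq> {}" by blast
    ultimately obtain z where z: "z \<in> F" "\<And>w. w \<in> F \<Longrightarrow> \<Phi> w \<le> \<Phi> z"
      using finite_maximizer[of F \<Phi>] by blast
    have "\<Phi> w \<le> B" if "w \<notin> F" for w using that by (simp add: F_def)
    then have max: "\<Phi> w \<le> \<Phi> z" for w
      using z unfolding F_def mem_Collect_eq by (cases "\<Phi> w > B") (auto simp: not_less)
    obtain n i m j where zz: "z = (n, i, m, j)" by (metis prod.exhaust)
    let ?t = "real n * (\<kappa> * h)" and ?x = "real i * h" and ?s = "real m * (\<kappa> * k)" and ?y = "real j * k"
    let ?U = "M h n i" and ?V = "M k m j"
    \<comment> \<open>\<open>B\<close> was chosen to absorb both completed squares. The gap at the
      maximum thus exceeds what the Lipschitz bounds allow, which rules out that either grid point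
      lies at time zero or on the space boundary; so the nodes needed for one scheme step exist on
      both grids.\<close>
    have quad: "?U - ?V > L * \<bar>?x - ?y\<bar> + C * \<bar>?t - ?s\<bar>"
    proof -
      have "L * \<bar>?x - ?y\<bar> - \<bar>?x - ?y\<bar>\<^sup>2 / (2 * \<epsilon>) \<le> L\<^sup>2 * \<epsilon> / 2"
        "C * \<bar>?t - ?s\<bar> - \<bar>?t - ?s\<bar>\<^sup>2 / (2 * \<epsilon>) \<le> C\<^sup>2 * \<epsilon> / 2"
        by (rule mult_diff_square_le[OF e])+
      moreover have "?U - ?V > B + ((?x - ?y)\<^sup>2 + (?t - ?s)\<^sup>2) / (2 * \<epsilon>)"
      proof -
        have "0 \<le> \<gamma> * (?t + ?s)" "0 \<le> \<beta> * (?x + ?y)" using gpos beta kh h k by auto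
        then show ?thesis using z(1) by (simp add: F_def zz \<Phi>_def \<psi>_def)
      qed
      ultimately show ?thesis by (simp add: B_def add_divide_distrib algebra_simps)
    qed
    have "n \<noteq> 0"
    proof
      assume "n = 0"
      then have "?U - ?V \<le> m0 ?x - m0 ?y + C * ?s"
        using M_ge_initial[OF k, of j m] by (simp add: M_0 mult_ac)
      then show False using m0_diff_le[of ?x ?y] quad h k kh \<open>n = 0\<close> by simp
    qed
    then obtain n' where n': "n = Suc n'" by (cases n) auto
    have "m \<noteq> 0"
    proof
      assume "m = 0"
      then have "?U - ?V \<le> m0 ?x - m0 ?y" using M_le_m0[OF h, of n i] by (simp add: M_0)
      moreover have "0 \<le> C * \<bar>?t - ?s\<bar>" using C_nonneg by simp
      ultimately show False using m0_diff_le[of ?x ?y] quad h k by simp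
    qed
    then obtain m' where m': "m = Suc m'" by (cases m) auto
    have nnq: "0 \<le> L * \<bar>?x - ?y\<bar>" "0 \<le> C * \<bar>?t - ?s\<bar>" using C_nonneg L_pos by auto
    have "i \<noteq> 0"
    proof
      assume "i = 0"
      then show False using quad M_nonneg[OF k, of m j] nnq by (simp add: M_boundary)
    qed
    then obtain i' where i': "i = Suc i'" by (cases i) auto
    have "j \<noteq> 0"
    proof
      assume "j = 0"
      then show False using quad M_le_linear[OF h, of n i] nnq h L_pos by (simp add: M_boundary)
    qed
    then obtain j' where j': "j = Suc j'" by (cases j) auto
    have UV: "?U \<ge> ?V" using quad nnq by linarith
    define p where "p = (?t - ?s) / \<epsilon>"
    define q where "q = (?x - ?y) / \<epsilon>"
    have tx: "real n' * (\<kappa> * h) = ?t - \<kappa> * h" "real i' * h = ?x - h"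
      "real m' * (\<kappa> * k) = ?s - \<kappa> * k" "real j' * k = ?y - k"
      by (auto simp: n' i' m' j' algebra_simps)
    \<comment> \<open>\<open>a\<close> is minus the backward difference quotient of
      \<open>\<psi>\<close> in \<open>t\<close>, and \<open>b\<close> below is the one in
      \<open>s\<close>. The terms over \<open>2 * \<epsilon>\<close> are the second-order remainders
      of the square.\<close>
    define a where "a = - p + \<kappa> * h / (2 * \<epsilon>) - \<gamma>"
    define b where "b = - p - \<kappa> * k / (2 * \<epsilon>) + \<gamma>"
    have 1: "?U * H (q - h / (2 * \<epsilon>) + \<beta>) \<le> a"
    proof (rule sub_step[OF h, of n' i', folded n' i'])
      have "M h n' i - ?U \<le> \<psi> (?t - \<kappa> * h) ?x ?s ?y - \<psi> ?t ?x ?s ?y"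
        using max[of "(n', i, m, j)"] by (simp add: zz \<Phi>_def tx)
      also have "\<dots> = a * (\<kappa> * h)" using e
        by (simp add: \<psi>_def a_def p_def field_simps power2_eq_square)
      finally show "M h n' i \<le> ?U + a * (\<kappa> * h)" by simp
      have "M h n' i' - ?U \<le> \<psi> (?t - \<kappa> * h) (?x - h) ?s ?y - \<psi> ?t ?x ?s ?y"
        using max[of "(n', i', m, j)"] by (simp add: zz \<Phi>_def tx)
      also have "\<dots> = a * (\<kappa> * h) - h * (q - h / (2 * \<epsilon>) + \<beta>)" using e
        by (simp add: \<psi>_def a_def p_def q_def field_simps power2_eq_square)
      finally show "M h n' i' \<le> ?U + a * (\<kappa> * h) - h * (q - h / (2 * \<epsilon>) + \<beta>)" by simp
    qed
    have 2: "?V * H (q + k / (2 * \<epsilon>) - \<beta>) \<ge> b"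
    proof (rule super_step[OF k, of m' j', folded m' j'])
      have "M k m' j - ?V \<ge> \<psi> ?t ?x ?s ?y - \<psi> ?t ?x (?s - \<kappa> * k) ?y"
        using max[of "(n, i, m', j)"] by (simp add: zz \<Phi>_def tx)
      also have "\<psi> ?t ?x ?s ?y - \<psi> ?t ?x (?s - \<kappa> * k) ?y = b * (\<kappa> * k)" using e
        by (simp add: \<psi>_def b_def p_def field_simps power2_eq_square)
      finally show "M k m' j \<ge> ?V + b * (\<kappa> * k)" by simp
      have "M k m' j' - ?V \<ge> \<psi> ?t ?x ?s ?y - \<psi> ?t ?x (?s - \<kappa> * k) (?y - k)"
        using max[of "(n, i, m', j')"] by (simp add: zz \<Phi>_def tx)
      also have "\<psi> ?t ?x ?s ?y - \<psi> ?t ?x (?s - \<kappa> * k) (?y - k)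
          = b * (\<kappa> * k) - k * (q + k / (2 * \<epsilon>) - \<beta>)" using e
        by (simp add: \<psi>_def b_def p_def q_def field_simps power2_eq_square)
      finally show "M k m' j' \<ge> ?V + b * (\<kappa> * k) - k * (q + k / (2 * \<epsilon>) - \<beta>)" by simp
    qed
    let ?H1 = "H (q - h / (2 * \<epsilon>))" and ?H2 = "H (q + k / (2 * \<epsilon>))"
    have U: "0 \<le> ?U" "?U \<le> S" "0 \<le> ?V" using M_nonneg M_le_S h k by auto
    have "?V * H (q + k / (2 * \<epsilon>) - \<beta>) \<le> ?V * ?H2"
      using U beta by (intro mult_left_mono H_mono) auto
    \<comment> \<open>This is where \<open>UV\<close> and the sign of \<open>H\<close> enter: the
      two values are merged before the two slopes are compared.\<close>
    also have "\<dots> \<le> ?U * ?H2" using UV H_nonneg by (intro mult_right_mono) auto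
    also have "\<dots> = ?U * ?H1 + ?U * (?H2 - ?H1)" by (simp add: algebra_simps)
    also have "\<dots> \<le> ?U * H (q - h / (2 * \<epsilon>) + \<beta>) + S * (K * ((h + k) / (2 * \<epsilon>)))"
    proof (rule add_mono)
      show "?U * ?H1 \<le> ?U * H (q - h / (2 * \<epsilon>) + \<beta>)"
        using U beta by (intro mult_left_mono H_mono) auto
      have le: "q - h / (2 * \<epsilon>) \<le> q + k / (2 * \<epsilon>)" using h k e
        by (smt (verit) divide_pos_pos)
      then have "?U * (?H2 - ?H1) \<le> S * (?H2 - ?H1)"
        using H_mono[OF le] U by (intro mult_right_mono) auto
      also have "\<dots> \<le> S * (K * ((q + k / (2 * \<epsilon>)) - (q - h / (2 * \<epsilon>))))"
        using H_diff_le[OF le] S_pos by (intro mult_left_mono) auto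
      also have "(q + k / (2 * \<epsilon>)) - (q - h / (2 * \<epsilon>)) = (h + k) / (2 * \<epsilon>)"
        by (simp add: add_divide_distrib)
      finally show "?U * (?H2 - ?H1) \<le> S * (K * ((h + k) / (2 * \<epsilon>)))" .
    qed
    finally have "b \<le> a + S * (K * ((h + k) / (2 * \<epsilon>)))" using 1 2 by linarith
    \<comment> \<open>The two time slopes contribute \<open>\<gamma>\<close> each, while all
      consistency errors together amount to \<open>\<gamma>\<close> by its definition.\<close>
    then have "2 * \<gamma> \<le> \<kappa> * h / (2 * \<epsilon>) + \<kappa> * k / (2 * \<epsilon>) + S * (K * ((h + k) / (2 * \<epsilon>)))"
      by (simp add: a_def b_def)
    also have "\<dots> = \<gamma>" unfolding g by (simp add: add_divide_distrib algebra_simps)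
    finally show False using gpos by simp
  qed
  then show "M h n i - M k m j \<le> (L\<^sup>2 + C\<^sup>2) * \<epsilon> / 2
     + ((real i * h - real j * k)\<^sup>2 + (real n * (\<kappa> * h) - real m * (\<kappa> * k))\<^sup>2) / (2 * \<epsilon>)
     + \<gamma> * (real n * (\<kappa> * h) + real m * (\<kappa> * k)) + \<beta> * (real i * h + real j * k)"
    unfolding \<Phi>_def \<psi>_def B_def prod.case by linarith
qed

section \<open>Lipschitz bounds for the interpolants and the estimate between two meshes\<close>

lemma mh_eq_interp: "mh m0 \<alpha> d h = interp d (\<kappa> * h) h (M h)"
  by (intro ext) (simp add: mh_def M_def htime_eq)

lemma mh_lipschitz_time:
  assumes "h > 0" "\<rho> \<ge> 0"
  shows "C-lipschitz_on {0..} (\<lambda>t. mh m0 \<alpha> d h t \<rho>)"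
  unfolding mh_eq_interp
proof (rule interp_lipschitz_time)
  show "\<bar>M h (Suc n) j - M h n j\<bar> \<le> C * (\<kappa> * h)" for n j
    using M_time_step[OF assms(1), of n j] by simp
qed (use assms kappa_pos in auto)

lemma mh_lipschitz_space:
  assumes "h > 0" "t \<ge> 0"
  shows "L-lipschitz_on {0..} (mh m0 \<alpha> d h t)"
  unfolding mh_eq_interp
proof (rule interp_lipschitz_space)
  show "\<bar>M h n (Suc j) - M h n j\<bar> \<le> L * h" for n j
    using M_mono_space[OF assms(1), of n j] M_space_step[OF assms(1), of n j] by simp
qed (use assms kappa_pos in auto)

lemma mh_diff_le:
  assumes "h > 0" "t \<ge> 0" "\<rho> \<ge> 0" "s \<ge> 0" "\<sigma> \<ge> 0"
  shows "\<bar>mh m0 \<alpha> d h t \<rho> - mh m0 \<alpha> d h s \<sigma>\<bar> \<le> C * \<bar>t - s\<bar> + L * \<bar>\<rho> - \<sigma>\<bar>"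
proof -
  have "\<bar>mh m0 \<alpha> d h t \<rho> - mh m0 \<alpha> d h s \<rho>\<bar> \<le> C * \<bar>t - s\<bar>"
    using lipschitz_onD[OF mh_lipschitz_time[OF assms(1,3)], of t s] assms by (simp add: dist_real_def)
  moreover have "\<bar>mh m0 \<alpha> d h s \<rho> - mh m0 \<alpha> d h s \<sigma>\<bar> \<le> L * \<bar>\<rho> - \<sigma>\<bar>"
    using lipschitz_onD[OF mh_lipschitz_space[OF assms(1,4)], of \<rho> \<sigma>] assms by (simp add: dist_real_def)
  ultimately show ?thesis by linarith
qed

lemma mh_node: "h > 0 \<Longrightarrow> mh m0 \<alpha> d h (real n * (\<kappa> * h)) (real j * h) = M h n j"
  using interp_eq_cell[of "\<kappa> * h" h 0 0 d "M h" n j] kappa_pos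
  by (simp add: mh_eq_interp cell_interp_def)

lemma mh_near_node:
  assumes h: "h > 0" and "t \<ge> 0" "\<rho> \<ge> 0"
  obtains n j where "real n * (\<kappa> * h) \<le> t" "t \<le> real n * (\<kappa> * h) + \<kappa> * h"
    "real j * h \<le> \<rho>" "\<rho> \<le> real j * h + h"
    "\<bar>mh m0 \<alpha> d h t \<rho> - M h n j\<bar> \<le> (C * \<kappa> + L) * h"
proof -
  obtain n where n: "real n * (\<kappa> * h) \<le> t" "t \<le> real n * (\<kappa> * h) + \<kappa> * h"
    using grid_decomposition[OF assms(2), of "\<kappa> * h"] kappa_pos h by (metis mult_pos_pos)
  obtain j where j: "real j * h \<le> \<rho>" "\<rho> \<le> real j * h + h"
    using grid_decomposition[OF assms(3) h] by metis
  have "\<bar>mh m0 \<alpha> d h t \<rho> - M h n j\<bar>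
      \<le> C * \<bar>t - real n * (\<kappa> * h)\<bar> + L * \<bar>\<rho> - real j * h\<bar>"
    using mh_diff_le[of h t \<rho> "real n * (\<kappa> * h)" "real j * h" d] assms kappa_pos
    by (simp add: mh_node)
  also have "\<dots> \<le> C * (\<kappa> * h) + L * h"
    using n j C_nonneg L_pos by (intro add_mono mult_left_mono) auto
  finally show ?thesis using that n j by (simp add: algebra_simps)
qed

text \<open>Coefficients of \<open>sqrt (h + k)\<close>, in order: replacing points by nodes, the
  completed squares, the mismatch of the two nodes, and the term in \<open>\<gamma>\<close> up to
  time \<open>t\<close>.\<close>

definition W where
  "W t = C * \<kappa> + L + (L\<^sup>2 + C\<^sup>2) / 2 + (1 + \<kappa>\<^sup>2) / 2 + (\<kappa> + S * K) * t"

lemma W_nonneg: "t \<ge> 0 \<Longrightarrow> W t \<ge> 0"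
  unfolding W_def using C_nonneg kappa_pos L_pos S_pos K_pos by (intro add_nonneg_nonneg) auto

lemma W_mono: "t \<le> t' \<Longrightarrow> W t \<le> W t'"
  unfolding W_def using kappa_pos S_pos K_pos by (intro add_left_mono mult_left_mono) auto

text \<open>Both interpolants are moved to the lower left nodes of their cells, and
  \<open>doubling\<close> is applied with \<open>\<epsilon> = r\<close>. The condition
  \<open>h + k \<le> 1\<close> reduces higher powers of \<open>r\<close> to
  \<open>r\<close>.\<close>

lemma mh_diff_le_sqrt:
  assumes h: "h > 0" and k: "k > 0" and hk: "h + k \<le> 1" and "t \<ge> 0" "\<rho> \<ge> 0"
  shows "mh m0 \<alpha> d h t \<rho> - mh m0 \<alpha> d k t \<rho> \<le> W t * sqrt (h + k)"
proof -
  define r where "r = sqrt (h + k)"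
  have r: "r > 0" "r \<le> 1" "r\<^sup>2 = h + k" using h k hk by (auto simp: r_def)
  obtain n i where n: "real n * (\<kappa> * h) \<le> t" "t \<le> real n * (\<kappa> * h) + \<kappa> * h"
    "real i * h \<le> \<rho>" "\<rho> \<le> real i * h + h" "\<bar>mh m0 \<alpha> d h t \<rho> - M h n i\<bar> \<le> (C * \<kappa> + L) * h"
    using mh_near_node[OF h assms(4,5)] by metis
  obtain m j where m: "real m * (\<kappa> * k) \<le> t" "t \<le> real m * (\<kappa> * k) + \<kappa> * k"
    "real j * k \<le> \<rho>" "\<rho> \<le> real j * k + k" "\<bar>mh m0 \<alpha> d k t \<rho> - M k m j\<bar> \<le> (C * \<kappa> + L) * k"
    using mh_near_node[OF k assms(4,5)] by metis
  let ?t = "real n * (\<kappa> * h)" and ?x = "real i * h" and ?s = "real m * (\<kappa> * k)" and ?y = "real j * k"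
  define g where "g = (\<kappa> + S * K) * (h + k) / (2 * r)"
  have g: "g = (\<kappa> + S * K) * r / 2" unfolding g_def r(3)[symmetric] using r(1)
    by (simp add: power2_eq_square)
  have kp: "0 < \<kappa> * h" "0 < \<kappa> * k" using kappa_pos h k by auto
  have "(?x - ?y)\<^sup>2 \<le> (r\<^sup>2)\<^sup>2"
    unfolding r(3) using n m h k by (intro power2_le_iff_abs_le[THEN iffD2]) auto
  moreover have "(?t - ?s)\<^sup>2 \<le> (\<kappa> * r\<^sup>2)\<^sup>2"
    unfolding r(3) using n m kp by (intro power2_le_iff_abs_le[THEN iffD2]) (auto simp: distrib_left)
  ultimately have "((?x - ?y)\<^sup>2 + (?t - ?s)\<^sup>2) / (2 * r) \<le> ((r\<^sup>2)\<^sup>2 + (\<kappa> * r\<^sup>2)\<^sup>2) / (2 * r)"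
    using r by (intro divide_right_mono) auto
  also have "\<dots> = (1 + \<kappa>\<^sup>2) / 2 * (r\<^sup>2 * r)" using r(1) by (simp add: field_simps power2_eq_square)
  also have "\<dots> \<le> (1 + \<kappa>\<^sup>2) / 2 * r"
    using r(1,2) by (intro mult_left_mono mult_left_le_one_le power_le_one) auto
  finally have 1: "((?x - ?y)\<^sup>2 + (?t - ?s)\<^sup>2) / (2 * r) \<le> (1 + \<kappa>\<^sup>2) / 2 * r" .
  have "g * (?t + ?s) \<le> g * (2 * t)"
    using n(1) m(1) r(1) kappa_pos S_pos K_pos unfolding g by (intro mult_left_mono) auto
  then have 2: "g * (?t + ?s) \<le> (\<kappa> + S * K) * t * r" by (simp add: g mult_ac)
  have "(C * \<kappa> + L) * h + (C * \<kappa> + L) * k = (C * \<kappa> + L) * r\<^sup>2" by (simp add: r(3) distrib_left)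
  also have "\<dots> \<le> (C * \<kappa> + L) * r"
    using r(1,2) C_nonneg kappa_pos L_pos by (intro mult_left_mono) (auto simp: power2_eq_square mult_le_one)
  finally have 3: "(C * \<kappa> + L) * h + (C * \<kappa> + L) * k \<le> (C * \<kappa> + L) * r" .
  have "M h n i - M k m j \<le> (L\<^sup>2 + C\<^sup>2) * r / 2
     + ((?x - ?y)\<^sup>2 + (?t - ?s)\<^sup>2) / (2 * r) + g * (?t + ?s)"
    by (rule doubling[OF h k r(1) g_def])
  then have "mh m0 \<alpha> d h t \<rho> - mh m0 \<alpha> d k t \<rho> \<le> (C * \<kappa> + L) * r + (L\<^sup>2 + C\<^sup>2) * r / 2
     + (1 + \<kappa>\<^sup>2) / 2 * r + (\<kappa> + S * K) * t * r"
    using 1 2 3 n(5) m(5) by linarith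
  also have "\<dots> = W t * r" by (simp add: W_def algebra_simps add_divide_distrib)
  finally show ?thesis by (simp add: r_def)
qed

subsection \<open>The limit\<close>

text \<open>One sequence of meshes names the limit; \<open>mh_sol_diff_le\<close> then controls all
  small meshes.\<close>

definition sol :: "bool \<Rightarrow> real \<Rightarrow> real \<Rightarrow> real" where
  "sol d t \<rho> = lim (\<lambda>n. mh m0 \<alpha> d (1 / real (Suc n)) t \<rho>)"

lemma sol_tendsto:
  assumes "t \<ge> 0" "\<rho> \<ge> 0"
  shows "(\<lambda>n. mh m0 \<alpha> d (1 / real (Suc n)) t \<rho>) \<longlonglongrightarrow> sol d t \<rho>"
proof -
  let ?f = "\<lambda>n. mh m0 \<alpha> d (1 / real (Suc n)) t \<rho>"
  have "Cauchy ?f"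
  proof (rule metric_CauchyI)
    fix e :: real assume "e > 0"
    have "(\<lambda>n. W t * sqrt (2 * (1 / real (Suc n)))) \<longlonglongrightarrow> W t * sqrt (2 * 0)"
      by (intro tendsto_intros filterlim_compose[OF LIMSEQ_inverse_real_of_nat[unfolded inverse_eq_divide]] filterlim_ident)
    then have "\<forall>\<^sub>F n in sequentially. W t * sqrt (2 * (1 / real (Suc n))) < e"
      using \<open>e > 0\<close> by (intro order_tendstoD(2)) auto
    \<comment> \<open>From index 1 on the meshes are at most 1/2, so two of them satisfy the
      smallness condition of \<open>mh_diff_le_sqrt\<close>.\<close>
    then have "\<forall>\<^sub>F n in sequentially. n \<ge> 1 \<and> W t * sqrt (2 * (1 / real (Suc n))) < e"
      using eventually_ge_at_top by (rule eventually_conj[rotated])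
    then obtain N where N: "N \<ge> 1" "W t * sqrt (2 * (1 / real (Suc N))) < e"
      unfolding eventually_sequentially by blast
    have less: "?f m - ?f n < e" if "m \<ge> N" "n \<ge> N" for m n
    proof -
      have inv: "1 / real (Suc m) \<le> 1 / real (Suc N)" "1 / real (Suc n) \<le> 1 / real (Suc N)"
        "1 / real (Suc N) \<le> 1 / 2"
        using that N(1) by (auto simp: field_simps)
      have "?f m - ?f n \<le> W t * sqrt (1 / real (Suc m) + 1 / real (Suc n))"
      proof (rule mh_diff_le_sqrt)
        show "1 / real (Suc m) + 1 / real (Suc n) \<le> 1" using inv by linarith
      qed (use assms in auto)
      also have "\<dots> \<le> W t * sqrt (2 * (1 / real (Suc N)))"
        using inv assms W_nonneg by (intro mult_left_mono real_sqrt_le_mono) auto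
      finally show ?thesis using N(2) by simp
    qed
    then show "\<exists>N. \<forall>m\<ge>N. \<forall>n\<ge>N. dist (?f m) (?f n) < e"
      by (intro exI[of _ N]) (auto simp: dist_real_def abs_less_iff)
  qed
  then show ?thesis unfolding sol_def by (rule Cauchy_convergent[THEN convergent_LIMSEQ_iff[THEN iffD1]])
qed

text \<open>Let the second mesh tend to zero in \<open>mh_diff_le_sqrt\<close>; \<open>h < 1\<close>
  leaves room for it.\<close>

lemma mh_sol_diff_le:
  assumes h: "0 < h" "h < 1" and t: "t \<ge> 0" "\<rho> \<ge> 0"
  shows "\<bar>mh m0 \<alpha> d h t \<rho> - sol d t \<rho>\<bar> \<le> W t * sqrt h"
proof (rule tendsto_le[OF trivial_limit_sequentially])
  have z: "(\<lambda>n. 1 / real (Suc n)) \<longlonglongrightarrow> 0"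
    using LIMSEQ_inverse_real_of_nat by (simp add: inverse_eq_divide)
  show "(\<lambda>n. \<bar>mh m0 \<alpha> d h t \<rho> - mh m0 \<alpha> d (1 / real (Suc n)) t \<rho>\<bar>) \<longlonglongrightarrow> \<bar>mh m0 \<alpha> d h t \<rho> - sol d t \<rho>\<bar>"
    by (intro tendsto_intros sol_tendsto t)
  have "(\<lambda>n. W t * sqrt (h + 1 / real (Suc n))) \<longlonglongrightarrow> W t * sqrt (h + 0)"
    by (intro tendsto_intros z)
  then show "(\<lambda>n. W t * sqrt (h + 1 / real (Suc n))) \<longlonglongrightarrow> W t * sqrt h" by simp
  have "\<forall>\<^sub>F n in sequentially. 1 / real (Suc n) < 1 - h"
    using h by (intro order_tendstoD(2)[OF z]) simp
  then show "\<forall>\<^sub>F n in sequentially. \<bar>mh m0 \<alpha> d h t \<rho> - mh m0 \<alpha> d (1 / real (Suc n)) t \<rho>\<bar>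
      \<le> W t * sqrt (h + 1 / real (Suc n))"
  proof eventually_elim
    case (elim n)
    then show ?case
      using mh_diff_le_sqrt[of h "1 / real (Suc n)" t \<rho> d] mh_diff_le_sqrt[of "1 / real (Suc n)" h t \<rho> d] h t
      by (simp add: add.commute)
  qed
qed

lemma sol_diff_le:
  assumes "t \<ge> 0" "\<rho> \<ge> 0" "s \<ge> 0" "\<sigma> \<ge> 0"
  shows "\<bar>sol d t \<rho> - sol d s \<sigma>\<bar> \<le> C * \<bar>t - s\<bar> + L * \<bar>\<rho> - \<sigma>\<bar>"
proof (rule LIMSEQ_le_const2)
  show "(\<lambda>n. \<bar>mh m0 \<alpha> d (1 / real (Suc n)) t \<rho> - mh m0 \<alpha> d (1 / real (Suc n)) s \<sigma>\<bar>)
    \<longlonglongrightarrow> \<bar>sol d t \<rho> - sol d s \<sigma>\<bar>"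
    by (intro tendsto_intros sol_tendsto assms)
  show "\<exists>N. \<forall>n\<ge>N. \<bar>mh m0 \<alpha> d (1 / real (Suc n)) t \<rho> - mh m0 \<alpha> d (1 / real (Suc n)) s \<sigma>\<bar>
      \<le> C * \<bar>t - s\<bar> + L * \<bar>\<rho> - \<sigma>\<bar>"
    using mh_diff_le assms by auto
qed

text \<open>Carries nodal facts over to the limit. The node is never to the right of or later than
  the point, so for \<open>t = 0\<close> or \<open>\<rho> = 0\<close> it lies on the initial line or
  on the boundary.\<close>

lemma sol_approx:
  assumes "t \<ge> 0" "\<rho> \<ge> 0" "e > 0"
  obtains h n j where "0 < h" "h < e" "real n * (\<kappa> * h) \<le> t" "real j * h \<le> \<rho>"
    "\<rho> \<le> real j * h + h" "\<bar>sol d t \<rho> - M h n j\<bar> < e"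
proof -
  have "((\<lambda>h. W t * sqrt h + (C * \<kappa> + L) * h) \<longlongrightarrow> W t * sqrt 0 + (C * \<kappa> + L) * 0) (at_right 0)"
    by (intro tendsto_intros)
  then have "\<forall>\<^sub>F h in at_right 0. W t * sqrt h + (C * \<kappa> + L) * h < e"
    using assms(3) by (intro order_tendstoD(2)) auto
  moreover have "\<forall>\<^sub>F h in at_right 0. h \<in> {0<..<min 1 e}"
    using assms(3) by (intro eventually_at_right_real) auto
  ultimately have "\<forall>\<^sub>F h in at_right 0. W t * sqrt h + (C * \<kappa> + L) * h < e \<and> h \<in> {0<..<min 1 e}"
    by (rule eventually_conj)
  then obtain h where h: "W t * sqrt h + (C * \<kappa> + L) * h < e" "0 < h" "h < 1" "h < e"
    using eventually_happens'[OF trivial_limit_at_right_real] by fastforce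
  obtain n j where nj: "real n * (\<kappa> * h) \<le> t" "real j * h \<le> \<rho>" "\<rho> \<le> real j * h + h"
    "\<bar>mh m0 \<alpha> d h t \<rho> - M h n j\<bar> \<le> (C * \<kappa> + L) * h"
    using mh_near_node[OF h(2) assms(1,2)] by metis
  moreover have "\<bar>sol d t \<rho> - M h n j\<bar> < e"
    using mh_sol_diff_le[OF h(2,3) assms(1,2), of d] nj(4) h(1) by linarith
  ultimately show ?thesis using that h by blast
qed

lemma sol_nonneg: "t \<ge> 0 \<Longrightarrow> \<rho> \<ge> 0 \<Longrightarrow> 0 \<le> sol d t \<rho>"
proof (rule field_le_epsilon)
  fix e :: real assume "t \<ge> 0" "\<rho> \<ge> 0" "e > 0"
  then obtain h n j where "0 < h" "\<bar>sol d t \<rho> - M h n j\<bar> < e" using sol_approx by metis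
  then show "0 \<le> sol d t \<rho> + e" using M_nonneg[of h n j] by linarith
qed

lemma sol_le_S: "t \<ge> 0 \<Longrightarrow> \<rho> \<ge> 0 \<Longrightarrow> sol d t \<rho> \<le> S"
proof (rule field_le_epsilon)
  fix e :: real assume "t \<ge> 0" "\<rho> \<ge> 0" "e > 0"
  then obtain h n j where "0 < h" "\<bar>sol d t \<rho> - M h n j\<bar> < e" using sol_approx by metis
  then show "sol d t \<rho> \<le> S + e" using M_le_S[of h n j] by linarith
qed

lemma sol_boundary: "t \<ge> 0 \<Longrightarrow> sol d t 0 = 0"
proof (rule antisym)
  assume t: "t \<ge> 0"
  show "sol d t 0 \<le> 0"
  proof (rule field_le_epsilon)
    fix e :: real assume "e > 0"
    then obtain h n j where "0 < h" "real j * h \<le> 0" "\<bar>sol d t 0 - M h n j\<bar> < e"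
      using sol_approx[OF t order_refl] by metis
    moreover from this have "j = 0" by (simp add: mult_le_0_iff)
    ultimately show "sol d t 0 \<le> 0 + e" by (simp add: M_boundary)
  qed
qed (simp add: sol_nonneg)

lemma sol_initial:
  assumes "\<rho> \<ge> 0"
  shows "sol d 0 \<rho> = m0 \<rho>"
proof -
  have "\<bar>sol d 0 \<rho> - m0 \<rho>\<bar> \<le> 0"
  proof (rule le_of_le_add_mult)
    fix e :: real assume "e > 0"
    then obtain h n j where h: "0 < h" "h < e" "real n * (\<kappa> * h) \<le> 0" "real j * h \<le> \<rho>"
      "\<rho> \<le> real j * h + h" "\<bar>sol d 0 \<rho> - M h n j\<bar> < e"
      using sol_approx[OF order_refl assms] by metis
    have "n = 0" using h(1,3) kappa_pos by (auto simp: mult_le_0_iff)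
    then have M: "M h n j = m0 (real j * h)" by (simp add: M_0)
    have "\<bar>m0 (real j * h) - m0 \<rho>\<bar> \<le> L * \<bar>real j * h - \<rho>\<bar>"
      using h assms by (intro m0_diff_le) auto
    also have "\<dots> \<le> L * e" using h L_pos by (intro mult_left_mono) auto
    finally show "\<bar>sol d 0 \<rho> - m0 \<rho>\<bar> \<le> 0 + e * (1 + L)"
      using h(6) by (simp add: M algebra_simps)
  qed (use L_pos in simp)
  then show ?thesis by simp
qed

section \<open>The value at infinity\<close>

lemma H_le_powr: "s \<le> c \<Longrightarrow> 0 \<le> c \<Longrightarrow> H s \<le> c powr \<alpha>"
  unfolding H_def Hfun_def using L_pos alpha by (intro powr_mono2) auto

text \<open>A discrete subsolution: a ramp rising from 0 at \<open>R\<close> to \<open>m0 R\<close>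
  at \<open>R + X\<close> has slope at most \<open>m0 R / X\<close>, so one step divides it by at
  most \<open>1 + x \<le> exp x\<close> with
  \<open>x = \<kappa> * h * (m0 R / X) powr \<alpha>\<close>. Monotonicity keeps \<open>M\<close>
  above it.\<close>

lemma scheme_barrier:
  assumes h: "h > 0" and R: "R \<ge> 0" and X: "X > 0"
  shows "m0 R * min 1 (max 0 ((real j * h - R) / X)) * exp (- ((m0 R / X) powr \<alpha> * (real n * (\<kappa> * h))))
    \<le> M h n j"
proof (induction n arbitrary: j)
  case 0
  show ?case
  proof (cases "real j * h \<ge> R")
    case True
    have "m0 R * min 1 (max 0 ((real j * h - R) / X)) \<le> m0 R * 1"
      using m0_nonneg[OF R] by (intro mult_left_mono) auto
    also have "\<dots> \<le> M h 0 j" using m0_mono[OF R True] by (simp add: M_0)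
    finally show ?thesis by simp
  next
    case False
    then have "(real j * h - R) / X \<le> 0" using X by (simp add: divide_simps)
    then show ?thesis using M_nonneg[OF h, of 0 j] by (simp add: max_def)
  qed
next
  case (Suc n)
  let ?c = "(m0 R / X) powr \<alpha>"
  let ?E = "exp (- (?c * (real n * (\<kappa> * h))))"
  define \<phi> where "\<phi> j = min 1 (max 0 ((real j * h - R) / X))" for j
  show ?case
  proof (cases j)
    case 0
    have "(0 - R) / X \<le> 0" using R X by (simp add: divide_simps)
    then show ?thesis using 0 by (simp add: M_boundary max_def)
  next
    case j: (Suc i)
    let ?a = "m0 R * \<phi> (Suc i) * ?E" and ?b = "m0 R * \<phi> i * ?E"
    have A: "0 \<le> m0 R" "m0 R \<le> S" using R m0_nonneg m0_le_S by auto
    have E: "0 \<le> ?E" "?E \<le> 1" using kappa_pos h by auto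
    have \<phi>: "0 \<le> \<phi> j" "\<phi> j \<le> 1" for j by (auto simp: \<phi>_def)
    have a0: "0 \<le> ?a" using A E \<phi> by simp
    have "?a \<le> S * 1 * 1" using A E \<phi> S_pos by (intro mult_mono) auto
    then have G: "G h ?a ?b \<le> M h (Suc n) (Suc i)"
      unfolding M_Suc using Suc.IH[of "Suc i"] Suc.IH[of i] M_nonneg[OF h] h
      by (intro G_mono) (auto simp: \<phi>_def)
    have "\<phi> (Suc i) - \<phi> i \<le> max 0 ((real (Suc i) * h - R) / X - (real i * h - R) / X)"
      unfolding \<phi>_def by linarith
    also have "(real (Suc i) * h - R) / X - (real i * h - R) / X = h / X"
      by (simp add: diff_divide_distrib[symmetric] algebra_simps)
    finally have d\<phi>: "\<phi> (Suc i) - \<phi> i \<le> h / X" using h X by (simp add: max_def)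
    have "?a - ?b = (m0 R * ?E) * (\<phi> (Suc i) - \<phi> i)" by (simp add: algebra_simps)
    also have "\<dots> \<le> (m0 R * ?E) * (h / X)" using A E d\<phi> by (intro mult_left_mono) auto
    also have "\<dots> \<le> (m0 R * 1) * (h / X)" using A E h X by (intro mult_right_mono mult_left_mono) auto
    finally have "(?a - ?b) / h \<le> (m0 R * 1) * (h / X) / h" using h by (intro divide_right_mono) auto
    also have "\<dots> = m0 R / X" using h by simp
    finally have "H ((?a - ?b) / h) \<le> ?c" using A X by (intro H_le_powr) auto
    then have "1 + \<kappa> * h * H ((?a - ?b) / h) \<le> 1 + \<kappa> * h * ?c"
      using kappa_pos h by (simp add: mult_left_mono)
    also have "\<dots> \<le> exp (\<kappa> * h * ?c)" by (rule exp_ge_add_one_self)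
    finally have "?a / exp (\<kappa> * h * ?c) \<le> G h ?a ?b"
      unfolding G_def using a0 denom_pos[OF h, of "(?a - ?b) / h"] by (intro divide_left_mono) auto
    moreover have "?a / exp (\<kappa> * h * ?c) = m0 R * \<phi> (Suc i) * exp (- (?c * (real (Suc n) * (\<kappa> * h))))"
    proof -
      have "- (?c * (real (Suc n) * (\<kappa> * h))) = - (?c * (real n * (\<kappa> * h))) - \<kappa> * h * ?c"
        by (simp add: algebra_simps)
      then show ?thesis by (simp add: exp_diff)
    qed
    ultimately show ?thesis using G by (simp add: j \<phi>_def)
  qed
qed

text \<open>The extra 1 absorbs the mesh: for \<open>h < 1\<close> the approximating node lies
  beyond the top of the ramp.\<close>

lemma sol_ge:
  assumes "t \<ge> 0" "R \<ge> 0" "X > 0" "\<rho> \<ge> R + X + 1"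
  shows "m0 R * (1 - (m0 R / X) powr \<alpha> * t) \<le> sol d t \<rho>"
proof (rule field_le_epsilon)
  fix e :: real assume "e > 0"
  let ?c = "(m0 R / X) powr \<alpha>"
  have "0 < min 1 e" "\<rho> \<ge> 0" using assms \<open>e > 0\<close> by auto
  then obtain h n j where h: "0 < h" "h < min 1 e" "real n * (\<kappa> * h) \<le> t" "\<rho> \<le> real j * h + h"
    "\<bar>sol d t \<rho> - M h n j\<bar> < min 1 e" using sol_approx[OF assms(1)] by metis
  have "(real j * h - R) / X \<ge> 1" using h assms by (simp add: divide_simps)
  then have one: "min 1 (max 0 ((real j * h - R) / X)) = 1" by (simp add: max_def)
  have A: "m0 R \<ge> 0" using assms m0_nonneg by auto
  have "1 - ?c * t \<le> exp (- (?c * t))" using exp_ge_add_one_self[of "- (?c * t)"] by simp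
  also have "\<dots> \<le> exp (- (?c * (real n * (\<kappa> * h))))" using h by (simp add: mult_left_mono)
  finally have "m0 R * (1 - ?c * t) \<le> m0 R * exp (- (?c * (real n * (\<kappa> * h))))"
    using A by (rule mult_left_mono)
  also have "\<dots> \<le> M h n j" using scheme_barrier[OF h(1) assms(2,3), of j n] by (simp add: one)
  finally show "m0 R * (1 - ?c * t) \<le> sol d t \<rho> + e" using h by linarith
qed

lemma sol_tendsto_S:
  assumes "t \<ge> 0"
  shows "(sol d t \<longlongrightarrow> S) at_top"
proof (rule order_tendstoI)
  fix a assume "S < a"
  then show "\<forall>\<^sub>F \<rho> in at_top. sol d t \<rho> < a"
    using order_le_less_trans[OF sol_le_S[OF assms]]
    by (intro eventually_mono[OF eventually_ge_at_top[of 0]])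
next
  fix a assume "a < S"
  define e where "e = (S - a) / 2"
  have e: "e > 0" using \<open>a < S\<close> by (simp add: e_def)
  obtain R where R: "R \<ge> 0" "m0 R > S - e" "m0 R \<ge> 0" using m0_near_S[OF e] by blast
  \<comment> \<open>A ramp of width \<open>S * y\<close> has slope at most \<open>1 / y\<close>,
    hence decay rate at most \<open>1 / y\<close> because \<open>\<alpha> \<ge> 1\<close>. By time
    \<open>t\<close> it loses at most \<open>S * t / y < e\<close>; the other \<open>e\<close> of
    the gap \<open>S - a\<close> was spent on choosing \<open>R\<close>.\<close>
  define y where "y = 1 + S * t / e"
  have y: "y \<ge> 1" using S_pos assms e by (simp add: y_def)
  have "m0 R / (S * y) \<le> S / (S * y)" using m0_le_S[OF R(1)] S_pos y by (intro divide_right_mono) auto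
  also have "\<dots> = 1 / y" using S_pos by simp
  finally have "(m0 R / (S * y)) powr \<alpha> \<le> (1 / y) powr \<alpha>"
    using R S_pos y alpha by (intro powr_mono2) auto
  also have "\<dots> \<le> (1 / y) powr 1" using y alpha by (intro powr_mono') auto
  also have "\<dots> = 1 / y" using y by simp
  finally have c: "(m0 R / (S * y)) powr \<alpha> \<le> 1 / y" .
  have "m0 R * ((m0 R / (S * y)) powr \<alpha> * t) \<le> S * (1 / y * t)"
    using c R S_pos y assms m0_le_S[OF R(1)] by (intro mult_mono) auto
  also have "\<dots> = S * t / y" by simp
  also have "\<dots> < e" using y e by (simp add: pos_divide_less_eq) (use e in \<open>simp add: y_def algebra_simps\<close>)
  finally have less: "a < m0 R * (1 - (m0 R / (S * y)) powr \<alpha> * t)"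
    using R(2) by (simp add: algebra_simps e_def field_simps)
  have "S * y > 0" using S_pos y by simp
  then have "a < sol d t \<rho>" if "\<rho> \<ge> R + S * y + 1" for \<rho>
    using less sol_ge[OF assms R(1) _ that] by (meson order_less_le_trans)
  then show "\<forall>\<^sub>F \<rho> in at_top. a < sol d t \<rho>"
    by (auto simp: eventually_at_top_linorder)
qed

lemma supnorm_sol:
  assumes "t \<ge> 0"
  shows "supnorm (sol d t) = S"
proof (rule antisym)
  have b: "\<bar>sol d t \<rho>\<bar> \<le> S" if "\<rho> \<ge> 0" for \<rho>
    using sol_nonneg[OF assms that] sol_le_S[OF assms that] by simp
  then show "supnorm (sol d t) \<le> S" unfolding supnorm_def by (intro cSUP_least) auto
  have "\<bar>sol d t \<rho>\<bar> \<le> supnorm (sol d t)" if "\<rho> \<ge> 0" for \<rho>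
    unfolding supnorm_def using that b by (intro cSUP_upper bdd_aboveI[of _ S]) auto
  then have "sol d t \<rho> \<le> supnorm (sol d t)" if "\<rho> \<ge> 0" for \<rho>
    using that abs_ge_self order_trans by blast
  then show "S \<le> supnorm (sol d t)"
    by (intro tendsto_upperbound[OF sol_tendsto_S[OF assms]]) 
      (auto simp: eventually_at_top_linorder)
qed

subsection \<open>Consistency\<close>

text \<open>A cone \<open>2 \<eta> |z - z\<^sub>0|\<close> added to the linear function makes the touching point strict; being
  \<open>2 \<eta>\<close>-Lipschitz, it changes the difference quotients at a discrete maximum by at most \<open>2 \<eta>\<close>.\<close>
lemma touching_node:
  fixes F :: "real \<Rightarrow> nat \<Rightarrow> nat \<Rightarrow> real" and f :: "real \<Rightarrow> real \<Rightarrow> real"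
  assumes F: "\<And>h n j. 0 < h \<Longrightarrow> h < 1 \<Longrightarrow>
      \<bar>F h n j - f (real n * (\<kappa> * h)) (real j * h)\<bar> \<le> W (real n * (\<kappa> * h)) * sqrt h"
    and f: "\<And>t \<rho> s \<sigma>. t \<ge> 0 \<Longrightarrow> \<rho> \<ge> 0 \<Longrightarrow> s \<ge> 0 \<Longrightarrow> \<sigma> \<ge> 0 \<Longrightarrow>
      \<bar>f t \<rho> - f s \<sigma>\<bar> \<le> C * \<bar>t - s\<bar> + L * \<bar>\<rho> - \<sigma>\<bar>"
    and p: "(p1, p2) \<in> superdiff f t0 r0" and t0: "t0 > 0" and r0: "r0 > 0" and eta: "\<eta> > 0"
  obtains h n j where "h > 0"
    "F h n (Suc j) \<le> F h (Suc n) (Suc j) + (2 * \<eta> - p1) * (\<kappa> * h)"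
    "F h n j \<le> F h (Suc n) (Suc j) + (2 * \<eta> - p1) * (\<kappa> * h) - h * (p2 - 2 * \<eta>)"
    "\<bar>F h (Suc n) (Suc j) - f t0 r0\<bar> \<le> \<eta>"
proof -
  obtain \<delta> where \<delta>: "\<delta> > 0" "\<And>s \<sigma>. dist (s, \<sigma>) (t0, r0) < \<delta> \<Longrightarrow>
      f s \<sigma> - f t0 r0 - (p1 * (s - t0) + p2 * (\<sigma> - r0)) \<le> \<eta> * dist (s, \<sigma>) (t0, r0)"
    using p eta unfolding superdiff_def by blast
  define r where "r = min \<delta> (min t0 r0)"
  have r: "r > 0" "r \<le> \<delta>" "r \<le> t0" "r \<le> r0" using \<delta> t0 r0 by (auto simp: r_def)
  \<comment> \<open>Bounds the change of \<open>f\<close> and of the test function, cone included,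
    between the touching point and the node just below it.\<close>
  define Q where "Q = C + L + \<bar>p1\<bar> + \<bar>p2\<bar> + 2 * \<eta>"
  have Q: "Q \<ge> 0" using C_nonneg L_pos eta by (simp add: Q_def)
  define w where "w h = W (2 * t0) * sqrt h" for h
  define g where "g h = (2 * w h + Q * ((\<kappa> + 1) * h)) / \<eta>" for h
  have "(w \<longlongrightarrow> W (2 * t0) * sqrt 0) (at_right 0)"
    unfolding w_def by (intro tendsto_intros)
  then have w0: "(w \<longlongrightarrow> 0) (at_right 0)" by simp
  have "(g \<longlongrightarrow> (2 * 0 + Q * ((\<kappa> + 1) * 0)) / \<eta>) (at_right 0)"
    unfolding g_def using eta by (intro tendsto_intros w0) auto
  then have g0: "(g \<longlongrightarrow> 0) (at_right 0)" by simp
  have "((\<lambda>h. w h + (C + L) * g h) \<longlongrightarrow> 0 + (C + L) * 0) (at_right 0)"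
    by (intro tendsto_intros w0 g0)
  then have "\<forall>\<^sub>F h in at_right 0. w h + (C + L) * g h < \<eta>"
    using eta by (intro order_tendstoD(2)) auto
  moreover have "\<forall>\<^sub>F h in at_right 0. g h < r / 2"
    using r by (intro order_tendstoD(2)[OF g0]) auto
  moreover have "\<forall>\<^sub>F h in at_right 0. h \<in> {0<..<min 1 (r / 2 / (\<kappa> + 1))}"
    using r kappa_pos by (intro eventually_at_right_real) auto
  ultimately have "\<forall>\<^sub>F h in at_right 0. w h + (C + L) * g h < \<eta> \<and> g h < r / 2 \<and> h \<in> {0<..<min 1 (r / 2 / (\<kappa> + 1))}"
    by (intro eventually_conj)
  then obtain h where h: "w h + (C + L) * g h < \<eta>" "g h < r / 2" "0 < h" "h < 1" "h < r / 2 / (\<kappa> + 1)"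
    using eventually_happens'[OF trivial_limit_at_right_real] by fastforce
  have hr: "\<kappa> * h + h < r / 2" using h(5) kappa_pos by (simp add: pos_less_divide_eq algebra_simps)
  have kh: "\<kappa> * h > 0" using kappa_pos h by simp
  define D where "D z = dist (real (fst z) * (\<kappa> * h), real (snd z) * h) (t0, r0)" for z :: "nat \<times> nat"
  define \<psi> where "\<psi> z = p1 * (real (fst z) * (\<kappa> * h) - t0) + p2 * (real (snd z) * h - r0) + 2 * \<eta> * D z"
    for z :: "nat \<times> nat"
  define \<Theta> where "\<Theta> z = F h (fst z) (snd z) - \<psi> z" for z
  define Z where "Z = {z. D z < r}"
  have D_le: "D z \<le> \<bar>real (fst z) * (\<kappa> * h) - t0\<bar> + \<bar>real (snd z) * h - r0\<bar>" for z
    unfolding D_def dist_prod_def by (simp add: dist_real_def sqrt_sum_squares_le_sum_abs)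
  have D_ge: "\<bar>real (fst z) * (\<kappa> * h) - t0\<bar> \<le> D z" "\<bar>real (snd z) * h - r0\<bar> \<le> D z" for z
    using dist_fst_le[of "(real (fst z) * (\<kappa> * h), real (snd z) * h)" "(t0, r0)"]
      dist_snd_le[of "(real (fst z) * (\<kappa> * h), real (snd z) * h)" "(t0, r0)"]
    by (simp_all add: D_def dist_real_def)
  have FZ: "\<bar>F h (fst z) (snd z) - f (real (fst z) * (\<kappa> * h)) (real (snd z) * h)\<bar> \<le> w h" if "z \<in> Z" for z
  proof -
    have "real (fst z) * (\<kappa> * h) \<le> 2 * t0" using D_ge(1)[of z] that r by (simp add: Z_def)
    then have "W (real (fst z) * (\<kappa> * h)) * sqrt h \<le> w h"
      unfolding w_def using h by (intro mult_right_mono W_mono) auto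
    then show ?thesis using F[OF h(3,4)] order_trans by blast
  qed
  obtain n0 where n0: "real n0 * (\<kappa> * h) \<le> t0" "t0 \<le> real n0 * (\<kappa> * h) + \<kappa> * h"
    using grid_decomposition[of t0 "\<kappa> * h"] t0 kh by (metis less_imp_le)
  obtain j0 where j0: "real j0 * h \<le> r0" "r0 \<le> real j0 * h + h"
    using grid_decomposition[of r0 h] r0 h by (metis less_imp_le)
  have D0: "D (n0, j0) \<le> \<kappa> * h + h" using D_le[of "(n0, j0)"] n0 j0 by simp
  then have z0: "(n0, j0) \<in> Z" using hr r by (simp add: Z_def)
  have "finite Z"
  proof -
    obtain N :: nat where N: "2 * t0 / (\<kappa> * h) \<le> N" "2 * r0 / h \<le> N"
      using real_nat_ceiling_ge[of "max (2 * t0 / (\<kappa> * h)) (2 * r0 / h)"] by auto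
    have "z \<in> {..N} \<times> {..N}" if "z \<in> Z" for z
    proof -
      have "real (fst z) * (\<kappa> * h) \<le> 2 * t0" "real (snd z) * h \<le> 2 * r0"
        using D_ge[of z] that r by (simp_all add: Z_def)
      then have "real (fst z) \<le> 2 * t0 / (\<kappa> * h)" "real (snd z) \<le> 2 * r0 / h"
        using kh h by (simp_all add: pos_le_divide_eq)
      then have "real (fst z) \<le> N" "real (snd z) \<le> N" using N by linarith+
      then show ?thesis by (cases z) simp
    qed
    then show ?thesis by (intro finite_subset[of Z "{..N} \<times> {..N}"]) auto
  qed
  then obtain z where z: "z \<in> Z" "\<And>v. v \<in> Z \<Longrightarrow> \<Theta> v \<le> \<Theta> z"
    using finite_maximizer[of Z \<Theta>] z0 by blast
  \<comment> \<open>The superdifferential inequality uses up one \<open>\<eta>\<close> of the cone;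
    the remaining \<open>\<eta> * D z\<close> forces the discrete maximum towards the touching
    point.\<close>
  have "\<Theta> z \<le> f t0 r0 + w h - \<eta> * D z"
  proof -
    have "f (real (fst z) * (\<kappa> * h)) (real (snd z) * h) - f t0 r0
        - (p1 * (real (fst z) * (\<kappa> * h) - t0) + p2 * (real (snd z) * h - r0)) \<le> \<eta> * D z"
      using \<delta>(2) z(1) r unfolding D_def Z_def by auto
    then show ?thesis using FZ[OF z(1)] by (simp add: \<Theta>_def \<psi>_def)
  qed
  moreover have "\<Theta> (n0, j0) \<ge> f t0 r0 - w h - Q * ((\<kappa> + 1) * h)"
  proof -
    let ?a = "real n0 * (\<kappa> * h) - t0" and ?b = "real j0 * h - r0"
    have ab: "\<bar>?a\<bar> \<le> \<kappa> * h + h" "\<bar>?b\<bar> \<le> \<kappa> * h + h" using n0 j0 kh h by auto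
    have "\<bar>f (real n0 * (\<kappa> * h)) (real j0 * h) - f t0 r0\<bar> \<le> C * \<bar>?a\<bar> + L * \<bar>?b\<bar>"
      using f[of "real n0 * (\<kappa> * h)" "real j0 * h" t0 r0] kh h t0 r0 by simp
    also have "\<dots> \<le> C * (\<kappa> * h + h) + L * (\<kappa> * h + h)"
      using ab C_nonneg L_pos by (intro add_mono mult_left_mono) auto
    finally have 1: "\<bar>f (real n0 * (\<kappa> * h)) (real j0 * h) - f t0 r0\<bar> \<le> \<dots>" .
    have "p1 * ?a + p2 * ?b \<le> \<bar>p1\<bar> * \<bar>?a\<bar> + \<bar>p2\<bar> * \<bar>?b\<bar>"
      by (metis abs_ge_self abs_mult add_mono)
    also have "\<dots> \<le> \<bar>p1\<bar> * (\<kappa> * h + h) + \<bar>p2\<bar> * (\<kappa> * h + h)"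
      using ab by (intro add_mono mult_left_mono) auto
    finally have 2: "p1 * ?a + p2 * ?b \<le> \<dots>" .
    have 3: "2 * \<eta> * D (n0, j0) \<le> 2 * \<eta> * (\<kappa> * h + h)" using D0 eta by simp
    have "Q * ((\<kappa> + 1) * h) = C * (\<kappa> * h + h) + L * (\<kappa> * h + h)
        + (\<bar>p1\<bar> * (\<kappa> * h + h) + \<bar>p2\<bar> * (\<kappa> * h + h)) + 2 * \<eta> * (\<kappa> * h + h)"
      by (simp add: Q_def algebra_simps)
    then show ?thesis using 1 2 3 FZ[OF z0] unfolding \<Theta>_def \<psi>_def fst_conv snd_conv by linarith
  qed
  ultimately have "\<eta> * D z \<le> 2 * w h + Q * ((\<kappa> + 1) * h)" using z(2)[OF z0] by linarith
  then have Dg: "D z \<le> g h" using eta by (simp add: g_def pos_le_divide_eq mult.commute)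
  \<comment> \<open>A node on an axis would have distance at least \<open>r\<close> from the
    touching point, but \<open>D z < r / 2\<close>.\<close>
  have "fst z \<noteq> 0"
  proof
    assume "fst z = 0"
    then show False using D_ge(1)[of z] Dg h(2) r by simp
  qed
  moreover have "snd z \<noteq> 0"
  proof
    assume "snd z = 0"
    then show False using D_ge(2)[of z] Dg h(2) r by simp
  qed
  ultimately obtain n j where nj: "z = (Suc n, Suc j)" by (metis not0_implies_Suc prod.collapse)
  have D1: "D (n, Suc j) \<le> D z + \<kappa> * h" "D (n, j) \<le> D z + (\<kappa> * h + h)"
  proof -
    have tri: "D v \<le> dist (real (fst v) * (\<kappa> * h), real (snd v) * h) (real (fst z) * (\<kappa> * h), real (snd z) * h) + D z" for v
      unfolding D_def by (rule dist_triangle)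
    have "D v \<le> \<bar>real (fst v) * (\<kappa> * h) - real (fst z) * (\<kappa> * h)\<bar> + \<bar>real (snd v) * h - real (snd z) * h\<bar> + D z" for v
      using tri[of v] sqrt_sum_squares_le_sum_abs[of "real (fst v) * (\<kappa> * h) - real (fst z) * (\<kappa> * h)" "real (snd v) * h - real (snd z) * h"]
      by (simp add: dist_prod_def dist_real_def)
    from this[of "(n, Suc j)"] this[of "(n, j)"]
    show "D (n, Suc j) \<le> D z + \<kappa> * h" "D (n, j) \<le> D z + (\<kappa> * h + h)"
      using kh h by (simp_all add: nj algebra_simps)
  qed
  \<comment> \<open>The other \<open>r / 2\<close> accommodates one grid step, so maximality of
    \<open>z\<close> applies to both nodes that the scheme reads.\<close>
  have nb: "(n, Suc j) \<in> Z" "(n, j) \<in> Z" using D1 Dg h hr kh by (auto simp: Z_def)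
  have e1: "2 * \<eta> * D (n, Suc j) \<le> 2 * \<eta> * (D z + \<kappa> * h)"
    "2 * \<eta> * D (n, j) \<le> 2 * \<eta> * (D z + (\<kappa> * h + h))"
    using D1 eta by simp_all
  show ?thesis
  proof
    show "h > 0" by (rule h(3))
    show "F h n (Suc j) \<le> F h (Suc n) (Suc j) + (2 * \<eta> - p1) * (\<kappa> * h)"
      using z(2)[OF nb(1)] e1(1) by (simp add: \<Theta>_def \<psi>_def nj algebra_simps)
    show "F h n j \<le> F h (Suc n) (Suc j) + (2 * \<eta> - p1) * (\<kappa> * h) - h * (p2 - 2 * \<eta>)"
      using z(2)[OF nb(2)] e1(2) by (simp add: \<Theta>_def \<psi>_def nj algebra_simps)
    have "\<bar>f (real (Suc n) * (\<kappa> * h)) (real (Suc j) * h) - f t0 r0\<bar>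
        \<le> C * \<bar>real (Suc n) * (\<kappa> * h) - t0\<bar> + L * \<bar>real (Suc j) * h - r0\<bar>"
      using kh h t0 r0 by (intro f) auto
    also have "\<dots> \<le> C * g h + L * g h"
      using D_ge[of z] Dg C_nonneg L_pos by (intro add_mono mult_left_mono) (auto simp: nj)
    finally show "\<bar>F h (Suc n) (Suc j) - f t0 r0\<bar> \<le> \<eta>"
      using FZ[OF z(1)] h(1) by (simp add: nj algebra_simps)
  qed
qed

text \<open>Increments of either sign in space at fixed time bound \<open>p2\<close> from both
  sides. For the limit this gives \<open>\<bar>p2\<bar> \<le> L\<close>, so that \<open>H p2\<close>
  is the untruncated power.\<close>

lemma superdiff_slope_le:
  fixes f :: "real \<Rightarrow> real \<Rightarrow> real"
  assumes f: "\<And>\<rho> \<sigma>. \<rho> \<ge> 0 \<Longrightarrow> \<sigma> \<ge> 0 \<Longrightarrow> \<bar>f t \<rho> - f t \<sigma>\<bar> \<le> B * \<bar>\<rho> - \<sigma>\<bar>"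
    and p: "(p1, p2) \<in> superdiff f t r0" and r0: "r0 > 0"
  shows "\<bar>p2\<bar> \<le> B"
proof (rule field_le_epsilon)
  fix e :: real assume "e > 0"
  then obtain \<delta> where \<delta>: "\<delta> > 0" "\<And>s \<sigma>. dist (s, \<sigma>) (t, r0) < \<delta> \<Longrightarrow>
      f s \<sigma> - f t r0 - (p1 * (s - t) + p2 * (\<sigma> - r0)) \<le> e * dist (s, \<sigma>) (t, r0)"
    using p unfolding superdiff_def by blast
  define \<tau> where "\<tau> = min \<delta> r0 / 2"
  have \<tau>: "\<tau> > 0" "\<tau> < \<delta>" "\<tau> < r0" using \<delta> r0 by (auto simp: \<tau>_def min_def)
  have le: "p2 * (- c) \<le> B * \<tau> + e * \<tau>" if "\<bar>c\<bar> = \<tau>" for c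
  proof -
    have "dist (t, r0 + c) (t, r0) = \<tau>" using that by (simp add: dist_Pair_Pair dist_real_def)
    then have "f t (r0 + c) - f t r0 - p2 * c \<le> e * \<tau>" using \<delta>(2)[of t "r0 + c"] \<tau> by simp
    moreover have "\<bar>f t (r0 + c) - f t r0\<bar> \<le> B * \<tau>" using f[of "r0 + c" r0] that \<tau> by simp
    ultimately show ?thesis by simp
  qed
  have "\<bar>p2\<bar> * \<tau> \<le> (B + e) * \<tau>" using le[of \<tau>] le[of "- \<tau>"] \<tau> by (simp add: abs_if algebra_simps)
  then show "\<bar>p2\<bar> \<le> B + e" using \<tau> by simp
qed

lemma superdiff_uminus: "(p1, p2) \<in> subdiff f t r0 \<Longrightarrow> (- p1, - p2) \<in> superdiff (\<lambda>s \<sigma>. - f s \<sigma>) t r0"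
  unfolding subdiff_def superdiff_def by (force simp: algebra_simps)

lemma H_eq: "p \<le> L \<Longrightarrow> H p = max p 0 powr \<alpha>"
  using L_pos by (simp add: H_def Hfun_def)

lemma M_sol_diff_le:
  "0 < h \<Longrightarrow> h < 1 \<Longrightarrow> \<bar>M h n j - sol d (real n * (\<kappa> * h)) (real j * h)\<bar> \<le> W (real n * (\<kappa> * h)) * sqrt h"
  using mh_sol_diff_le[of h "real n * (\<kappa> * h)" "real j * h" d] kappa_pos by (simp add: mh_node)

text \<open>\<open>touching_node\<close> delivers the hypotheses of \<open>sub_step\<close> with
  \<open>a = 2 * \<eta> - p1\<close> and slope \<open>p2 - 2 * \<eta>\<close>. Undoing the shifts of
  slope and value costs a multiple of \<open>\<eta>\<close>, which tends to zero.\<close>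

lemma sol_superdiff:
  assumes "t > 0" "\<rho> > 0" and p: "(p1, p2) \<in> superdiff (sol d) t \<rho>"
  shows "p1 + max p2 0 powr \<alpha> * sol d t \<rho> \<le> 0"
proof -
  have "\<bar>p2\<bar> \<le> L" using sol_diff_le[of t _ t] assms by (intro superdiff_slope_le[OF _ p]) force+
  then have H: "H p2 = max p2 0 powr \<alpha>" by (intro H_eq) auto
  have "p1 + H p2 * sol d t \<rho> \<le> 0"
  proof (rule le_of_le_add_mult)
    fix \<eta> :: real assume eta: "\<eta> > 0"
    obtain h n j where *: "h > 0"
      "M h n (Suc j) \<le> M h (Suc n) (Suc j) + (2 * \<eta> - p1) * (\<kappa> * h)"
      "M h n j \<le> M h (Suc n) (Suc j) + (2 * \<eta> - p1) * (\<kappa> * h) - h * (p2 - 2 * \<eta>)"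
      "\<bar>M h (Suc n) (Suc j) - sol d t \<rho>\<bar> \<le> \<eta>"
      using touching_node[OF M_sol_diff_le sol_diff_le p assms(1,2) eta] by blast
    let ?M = "M h (Suc n) (Suc j)"
    have M: "0 \<le> ?M" "?M \<le> S" using M_nonneg M_le_S * by auto
    have "H p2 * sol d t \<rho> \<le> H p2 * (?M + \<eta>)" using * H_nonneg by (intro mult_left_mono) auto
    also have "\<dots> \<le> ?M * H p2 + L powr \<alpha> * \<eta>" using H_le eta by (simp add: algebra_simps)
    also have "?M * H p2 \<le> ?M * (H (p2 - 2 * \<eta>) + K * (2 * \<eta>))"
      using H_diff_le[of "p2 - 2 * \<eta>" p2] eta M by (intro mult_left_mono) auto
    also have "\<dots> = ?M * H (p2 - 2 * \<eta>) + ?M * (K * (2 * \<eta>))" by (simp add: algebra_simps)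
    also have "\<dots> \<le> (2 * \<eta> - p1) + S * (K * (2 * \<eta>))"
      using sub_step[OF *(1-3)] M K_pos eta by (intro add_mono mult_right_mono) auto
    finally show "p1 + H p2 * sol d t \<rho> \<le> 0 + \<eta> * (2 + 2 * S * K + L powr \<alpha>)"
      by (simp add: algebra_simps)
  qed (use S_pos K_pos in simp)
  then show ?thesis by (simp add: H)
qed

text \<open>Touching from below is touching from above for the negatives, so
  \<open>touching_node\<close> is applied to \<open>- M\<close> and \<open>- sol d\<close>. Negating
  back gives \<open>super_step\<close> with \<open>a = - p1 - 2 * \<eta>\<close> and slope
  \<open>p2 + 2 * \<eta>\<close>.\<close>

lemma sol_subdiff:
  assumes "t > 0" "\<rho> > 0" and p: "(p1, p2) \<in> subdiff (sol d) t \<rho>"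
  shows "p1 + max p2 0 powr \<alpha> * sol d t \<rho> \<ge> 0"
proof -
  note p' = superdiff_uminus[OF p]
  have "\<bar>- p2\<bar> \<le> L" using sol_diff_le[of t _ t] assms
    by (intro superdiff_slope_le[OF _ p']) (force simp: abs_minus_commute)+
  then have H: "H p2 = max p2 0 powr \<alpha>" by (intro H_eq) auto
  have "- p1 \<le> H p2 * sol d t \<rho>"
  proof (rule le_of_le_add_mult)
    fix \<eta> :: real assume eta: "\<eta> > 0"
    have F: "\<bar>- M h n j - - sol d (real n * (\<kappa> * h)) (real j * h)\<bar> \<le> W (real n * (\<kappa> * h)) * sqrt h"
      if "0 < h" "h < 1" for h n j using M_sol_diff_le[OF that] by (simp add: abs_minus_commute)
    have f: "\<bar>- sol d t \<rho> - - sol d s \<sigma>\<bar> \<le> C * \<bar>t - s\<bar> + L * \<bar>\<rho> - \<sigma>\<bar>"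
      if "t \<ge> 0" "\<rho> \<ge> 0" "s \<ge> 0" "\<sigma> \<ge> 0" for t \<rho> s \<sigma>
      using sol_diff_le[OF that] by (simp add: abs_minus_commute)
    obtain h n j where *: "h > 0"
      "- M h n (Suc j) \<le> - M h (Suc n) (Suc j) + (2 * \<eta> - - p1) * (\<kappa> * h)"
      "- M h n j \<le> - M h (Suc n) (Suc j) + (2 * \<eta> - - p1) * (\<kappa> * h) - h * (- p2 - 2 * \<eta>)"
      "\<bar>- M h (Suc n) (Suc j) - - sol d t \<rho>\<bar> \<le> \<eta>"
      using touching_node[where F = "\<lambda>h n j. - M h n j", OF F f p' assms(1,2) eta] by blast
    let ?M = "M h (Suc n) (Suc j)"
    have M: "0 \<le> ?M" "?M \<le> S" using M_nonneg M_le_S * by auto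
    have "?M * H (p2 + 2 * \<eta>) \<ge> - p1 - 2 * \<eta>"
      using *(1-3) by (intro super_step) (auto simp: algebra_simps)
    moreover have "?M * H (p2 + 2 * \<eta>) \<le> ?M * (H p2 + K * (2 * \<eta>))"
      using H_diff_le[of p2 "p2 + 2 * \<eta>"] eta M by (intro mult_left_mono) auto
    moreover have "?M * (H p2 + K * (2 * \<eta>)) = ?M * H p2 + ?M * (K * (2 * \<eta>))" by (simp add: algebra_simps)
    moreover have "?M * (K * (2 * \<eta>)) \<le> S * (K * (2 * \<eta>))"
      using M K_pos eta by (intro mult_right_mono) auto
    moreover have "?M * H p2 \<le> (sol d t \<rho> + \<eta>) * H p2"
      using * H_nonneg by (intro mult_right_mono) auto
    moreover have "(sol d t \<rho> + \<eta>) * H p2 \<le> H p2 * sol d t \<rho> + L powr \<alpha> * \<eta>"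
      using H_le eta by (simp add: algebra_simps)
    ultimately have "- p1 - 2 * \<eta> \<le> H p2 * sol d t \<rho> + L powr \<alpha> * \<eta> + S * (K * (2 * \<eta>))" by linarith
    then show "- p1 \<le> H p2 * sol d t \<rho> + \<eta> * (2 + 2 * S * K + L powr \<alpha>)"
      by (simp add: algebra_simps)
  qed (use S_pos K_pos in simp)
  then show ?thesis by (simp add: H)
qed

section \<open>Continuity, locally uniform convergence and the final statement\<close>

lemma sol_continuous: "continuous_on ({0..} \<times> {0..}) (\<lambda>(t, \<rho>). sol d t \<rho>)"
proof -
  have "(C + L)-lipschitz_on ({0..} \<times> {0..}) (\<lambda>(t, \<rho>). sol d t \<rho>)"
  proof (rule lipschitz_onI)
    fix x y :: "real \<times> real" assume "x \<in> {0..} \<times> {0..}" "y \<in> {0..} \<times> {0..}"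
    then obtain t \<rho> s \<sigma> where xy: "x = (t, \<rho>)" "y = (s, \<sigma>)" "t \<ge> 0" "\<rho> \<ge> 0" "s \<ge> 0" "\<sigma> \<ge> 0" by auto
    have "\<bar>sol d t \<rho> - sol d s \<sigma>\<bar> \<le> C * \<bar>t - s\<bar> + L * \<bar>\<rho> - \<sigma>\<bar>" by (rule sol_diff_le[OF xy(3-)])
    also have "\<dots> \<le> C * dist x y + L * dist x y"
      using dist_fst_le[of x y] dist_snd_le[of x y] C_nonneg L_pos
      by (intro add_mono mult_left_mono) (auto simp: xy dist_real_def)
    finally show "dist (case x of (t, \<rho>) \<Rightarrow> sol d t \<rho>) (case y of (t, \<rho>) \<Rightarrow> sol d t \<rho>) \<le> (C + L) * dist x y"
      by (simp add: xy dist_real_def distrib_right)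
  qed (use C_nonneg L_pos in simp)
  then show ?thesis by (rule lipschitz_on_continuous_on)
qed

lemma visc_sol_sol: "visc_sol \<alpha> m0 (sol d)"
  unfolding visc_sol_def visc_sub_def visc_super_def
  using sol_continuous sol_superdiff sol_subdiff sol_initial sol_boundary by auto

lemma sol_uniform_limit:
  assumes "T > 0"
  shows "uniform_limit ({0..T} \<times> {0..P}) (\<lambda>h (t, \<rho>). mh m0 \<alpha> d h t \<rho>) (\<lambda>(t, \<rho>). sol d t \<rho>) (at_right 0)"
proof (rule uniform_limitI)
  fix e :: real assume "e > 0"
  have "((\<lambda>h. W T * sqrt h) \<longlongrightarrow> W T * sqrt 0) (at_right 0)" by (intro tendsto_intros)
  then have "\<forall>\<^sub>F h in at_right 0. W T * sqrt h < e"
    using \<open>e > 0\<close> by (intro order_tendstoD(2)) auto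
  moreover have "\<forall>\<^sub>F h :: real in at_right 0. h \<in> {0<..<1}" by (intro eventually_at_right_real) auto
  ultimately show "\<forall>\<^sub>F h in at_right 0. \<forall>x\<in>{0..T} \<times> {0..P}.
      dist (case x of (t, \<rho>) \<Rightarrow> mh m0 \<alpha> d h t \<rho>) (case x of (t, \<rho>) \<Rightarrow> sol d t \<rho>) < e"
  proof eventually_elim
    case (elim h)
    have "\<bar>mh m0 \<alpha> d h t \<rho> - sol d t \<rho>\<bar> < e" if "0 \<le> t" "t \<le> T" "0 \<le> \<rho>" for t \<rho>
    proof -
      have "\<bar>mh m0 \<alpha> d h t \<rho> - sol d t \<rho>\<bar> \<le> W t * sqrt h" using elim that by (intro mh_sol_diff_le) auto
      also have "\<dots> \<le> W T * sqrt h" using elim that by (intro mult_right_mono W_mono) auto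
      finally show ?thesis using elim by simp
    qed
    then show ?case by (auto simp: dist_real_def)
  qed
qed

lemma mh_uniformly_lipschitz:
  assumes "h > 0" "t \<ge> 0" "\<rho> \<ge> 0" "s \<ge> 0" "\<sigma> \<ge> 0"
  shows "\<bar>mh m0 \<alpha> d h t \<rho> - mh m0 \<alpha> d h s \<sigma>\<bar> \<le> (C + L) * dist (t, \<rho>) (s, \<sigma>)"
proof -
  have "\<bar>mh m0 \<alpha> d h t \<rho> - mh m0 \<alpha> d h s \<sigma>\<bar> \<le> C * \<bar>t - s\<bar> + L * \<bar>\<rho> - \<sigma>\<bar>"
    by (rule mh_diff_le[OF assms])
  also have "\<dots> \<le> C * dist (t, \<rho>) (s, \<sigma>) + L * dist (t, \<rho>) (s, \<sigma>)"
    using dist_fst_le[of "(t, \<rho>)" "(s, \<sigma>)"] dist_snd_le[of "(t, \<rho>)" "(s, \<sigma>)"] C_nonneg L_pos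
    by (intro add_mono mult_left_mono) (auto simp: dist_real_def)
  finally show ?thesis by (simp add: distrib_right)
qed

lemma sol_lipschitz: "t \<ge> 0 \<Longrightarrow> L-lipschitz_on {0..} (sol d t)"
proof (rule lipschitz_onI)
  fix x y :: real assume "t \<ge> 0" "x \<in> {0..}" "y \<in> {0..}"
  then show "dist (sol d t x) (sol d t y) \<le> L * dist x y"
    using sol_diff_le[of t x t y d] by (simp add: dist_real_def)
qed (use L_pos in simp)

end

theorem mainTheorem12:
  fixes \<alpha> :: real and m0 :: "real \<Rightarrow> real" and d :: bool
  assumes alpha: "\<alpha> \<ge> 1"
    and bdd: "bounded (m0 ` {0..})"
    and lip: "\<exists>L. L-lipschitz_on {0..} m0"
    and nonneg: "\<forall>\<rho>\<ge>0. m0 \<rho> \<ge> 0"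
    and mono: "mono_on {0..} m0"
    and zero: "m0 0 = 0"
    and nontriv: "\<exists>\<rho>\<ge>0. m0 \<rho> \<noteq> 0"
  shows "(\<exists>L. \<forall>h>0. \<forall>t\<ge>0. \<forall>\<rho>\<ge>0. \<forall>s\<ge>0. \<forall>\<sigma>\<ge>0.
            \<bar>mh m0 \<alpha> d h t \<rho> - mh m0 \<alpha> d h s \<sigma>\<bar> \<le> L * dist (t, \<rho>) (s, \<sigma>))
       \<and> (\<exists>m. visc_sol \<alpha> m0 m
            \<and> (\<forall>T>0. \<forall>P>0. uniform_limit ({0..T} \<times> {0..P})
                   (\<lambda>h (t, \<rho>). mh m0 \<alpha> d h t \<rho>) (\<lambda>(t, \<rho>). m t \<rho>) (at_right 0))
            \<and> (\<forall>t\<ge>0. supnorm (m t) = supnorm m0 \<and> ((m t) \<longlongrightarrow> supnorm m0) at_top)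
            \<and> (\<forall>t\<ge>0. (lipconst m0)-lipschitz_on {0..} (m t)))"
proof -
  interpret mass_datum \<alpha> m0 by (rule mass_datum.intro[OF assms])
  show ?thesis
  proof (intro conjI exI allI impI)
    show "\<bar>mh m0 \<alpha> d h t \<rho> - mh m0 \<alpha> d h s \<sigma>\<bar> \<le> (C + L) * dist (t, \<rho>) (s, \<sigma>)"
      if "h > 0" "t \<ge> 0" "\<rho> \<ge> 0" "s \<ge> 0" "\<sigma> \<ge> 0" for h t \<rho> s \<sigma>
      by (rule mh_uniformly_lipschitz[OF that])
    show "visc_sol \<alpha> m0 (sol d)" by (rule visc_sol_sol)
    show "uniform_limit ({0..T} \<times> {0..P}) (\<lambda>h (t, \<rho>). mh m0 \<alpha> d h t \<rho>) (\<lambda>(t, \<rho>). sol d t \<rho>) (at_right 0)"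
      if "T > 0" for T P using that by (rule sol_uniform_limit)
    fix t :: real assume t: "t \<ge> 0"
    show "supnorm (sol d t) = supnorm m0" using supnorm_sol[OF t] by (simp add: S_def)
    show "(sol d t \<longlongrightarrow> supnorm m0) at_top" using sol_tendsto_S[OF t] by (simp add: S_def)
    show "(lipconst m0)-lipschitz_on {0..} (sol d t)" using sol_lipschitz[OF t] by (simp add: L_def)
  qed
qed

end
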